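(* Let $n \ge 3$. There exists a primitive permutation action of $\mathrm{SL}(n,\mathbb{Z})$ which is not $2$-transitive.
   Context: A permutation action of a group $G$ on a set $X$ is primitive if it is transitive and preserves no equivalence relation on $X$ other than the two trivial ones (for $|X|\ge 2$, equivalently, it is transitive and point stabilizers are maximal subgroups of $G$). It is $2$-transitive if $G$ acts transitively on ordered pairs of distinct elements of $X$. *)

theory Defs
  imports "Jordan_Normal_Form.Determinant" "HOL-Algebra.Group_Action"
begin

definition SL :: "nat \<Rightarrow> 'a::comm_ring_1 mat monoid" where
  "SL n = \<lparr>carrier = {A \<in> carrier_mat n n. det A = 1}, mult = (*), one = 1\<^sub>m n\<rparr>"

lemma group_SL: "group (SL n)"
proof (rule groupI)
  fix A :: "'a mat" assume "A \<in> carrier (SL n)"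
  then have A: "A \<in> carrier_mat n n" and d: "det A = 1"
    by (auto simp: SL_def)
  note adj = adj_mat[OF A]
  have eq: "adj_mat A * A = 1\<^sub>m n"
    using adj(3) d by (simp add: smult_mat_def) (auto intro!: eq_matI)
  have "det (adj_mat A) * det A = det (adj_mat A * A)"
    by (rule det_mult[OF adj(1) A, symmetric])
  then have "det (adj_mat A) = 1"
    using d eq by simp
  then show "\<exists>B\<in>carrier (SL n). B \<otimes>\<^bsub>SL n\<^esub> A = \<one>\<^bsub>SL n\<^esub>"
    using adj(1) eq by (intro bexI[of _ "adj_mat A"]) (auto simp: SL_def)
qed (auto simp: SL_def det_mult assoc_mult_mat)

text \<open>
  For a group, the one-directional invariance of \<open>R\<close> below is the same as
  \<open>(x, y) \<in> R \<longleftrightarrow> (\<phi> g x, \<phi> g y) \<in> R\<close>, by applying it to \<open>g\<close> and to its inverse.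
\<close>

locale primitive_action = transitive_action +
  assumes primitive:
    "\<lbrakk> equiv E R; \<And>g x y. \<lbrakk> g \<in> carrier G; (x, y) \<in> R \<rbrakk> \<Longrightarrow> (\<phi> g x, \<phi> g y) \<in> R \<rbrakk>
      \<Longrightarrow> R = Id_on E \<or> R = E \<times> E"

locale two_transitive_action = group_action +
  assumes two_transitive:
    "\<lbrakk> x1 \<in> E; x2 \<in> E; x1 \<noteq> x2; y1 \<in> E; y2 \<in> E; y1 \<noteq> y2 \<rbrakk>
      \<Longrightarrow> \<exists>g \<in> carrier G. \<phi> g x1 = y1 \<and> \<phi> g x2 = y2"

text \<open>
  An existential statement about actions of \<open>SL n\<close> over the integers may take the set acted on
  inside \<open>int mat set\<close>: a transitive action on a nonempty set is isomorphic to the action on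
  the cosets of a point stabilizer.
\<close>

end

theory Submission
  imports Defs "HOL-Number_Theory.Cong"
begin

text \<open>
  The set acted on is the space of left cosets of a maximal subgroup \<open>M\<close>. Maximality makes the action
  primitive (\<open>coset_action_primitive\<close>). If it were 2-transitive, the elements outside \<open>M\<close> would form a
  single double coset of \<open>M\<close>; so two elements outside \<open>M\<close> in different double cosets suffice
  (\<open>coset_action_not_two_transitive\<close>). In both cases below \<open>M\<close> is a congruence subgroup, so the action
  is an action of a finite quotient of \<open>SL(n, \<int>)\<close>.

  For \<open>n \<ge> 4\<close>, \<open>M\<close> is the stabilizer of a plane in the \<open>n\<close>-dimensional space over the field with two
  elements. Two distinct planes may meet in a line or trivially, which gives two double cosets. A subgroup
  properly containing \<open>M\<close> contains a transvection that moves the plane; clearing its entries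
  with elements of \<open>M\<close> yields an elementary matrix outside \<open>M\<close>, and then all of them
  (\<open>plane_stabilizer_maximal\<close>).

  For \<open>n = 3\<close> a plane is a hyperplane and that action is 2-transitive. Here \<open>M\<close> is the preimage of a
  complement in \<open>SL(3, \<int>/4)\<close> to the kernel \<open>K\<close> of the reduction to \<open>SL(3, \<int>/2)\<close>. Such a complement
  exists because \<open>SL(3, \<int>/2)\<close>, isomorphic to \<open>PSL(2, 7)\<close>, has a 3-dimensional representation over
  \<open>\<rat>(\<surd>-7)\<close>, and \<open>-7\<close> is a square in the 2-adic integers. The kernel consists of the matrices
  \<open>1 + 2 A\<close> with \<open>A\<close> of trace zero modulo 2. It is an irreducible module for \<open>SL(3, \<int>/2)\<close>, so \<open>M\<close> is maximal
  (\<open>lift_stabilizer_maximal\<close>). The cosets of \<open>M\<close> correspond to the points of \<open>K\<close>, and \<open>M\<close> acts on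
  them by conjugation of \<open>A\<close>; matrices of rank 1 and 2 lie in different orbits.
\<close>

(* Otherwise a left coset also parses as a comparison of multisets. *)
no_notation (ASCII) subset_mset (infix \<open><#\<close> 50)

section \<open>Primitive actions on cosets\<close>

definition coset_space :: "('a, 'b) monoid_scheme \<Rightarrow> 'a set \<Rightarrow> 'a set set" where
  "coset_space G M = {g <#\<^bsub>G\<^esub> M | g. g \<in> carrier G}"

definition coset_action :: "('a, 'b) monoid_scheme \<Rightarrow> 'a set \<Rightarrow> 'a \<Rightarrow> 'a set \<Rightarrow> 'a set" where
  "coset_action G M g = (\<lambda>C \<in> coset_space G M. g <#\<^bsub>G\<^esub> C)"

context group
begin

lemma coset_action_coset:
  assumes "subgroup M G" "g \<in> carrier G" "h \<in> carrier G"
  shows "coset_action G M g (h <# M) = (g \<otimes> h) <# M"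
  using assms lcos_m_assoc[OF subgroup.subset[OF assms(1)]]
  by (auto simp: coset_action_def coset_space_def)

lemma coset_in_coset_space: "g \<in> carrier G \<Longrightarrow> g <# M \<in> coset_space G M"
  by (auto simp: coset_space_def)

lemma lcos_eq_iff:
  assumes "subgroup M G" "g \<in> carrier G" "h \<in> carrier G"
  shows "g <# M = h <# M \<longleftrightarrow> inv g \<otimes> h \<in> M"
proof
  assume "g <# M = h <# M"
  moreover have "h \<in> h <# M"
    using assms subgroup.one_closed[OF assms(1)] by (force simp: l_coset_def)
  ultimately obtain m where "m \<in> M" "h = g \<otimes> m"
    by (auto simp: l_coset_def)
  then show "inv g \<otimes> h \<in> M"
    using assms subgroup.mem_carrier[OF assms(1)] by (simp add: m_assoc[symmetric])
next
  assume m: "inv g \<otimes> h \<in> M"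
  have "h = g \<otimes> (inv g \<otimes> h)"
    using assms by (simp add: m_assoc[symmetric])
  then have "h \<in> g <# M"
    using m by (auto simp: l_coset_def)
  then show "g <# M = h <# M"
    using assms by (intro l_repr_independence)
qed

lemma coset_action_transitive:
  assumes M: "subgroup M G"
  shows "transitive_action G (coset_space G M) (coset_action G M)"
proof -
  have Bij: "coset_action G M g \<in> Bij (coset_space G M)" if g: "g \<in> carrier G" for g
  proof -
    have "bij_betw (coset_action G M g) (coset_space G M) (coset_space G M)"
    proof (rule bij_betwI[where g = "coset_action G M (inv g)"])
      show "coset_action G M g \<in> coset_space G M \<rightarrow> coset_space G M"
        "coset_action G M (inv g) \<in> coset_space G M \<rightarrow> coset_space G M"
        using g M by (auto simp: coset_space_def coset_action_coset)
      show "coset_action G M (inv g) (coset_action G M g C) = C"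
        "coset_action G M g (coset_action G M (inv g) C) = C" if C: "C \<in> coset_space G M" for C
        using C g M by (auto simp: coset_space_def coset_action_coset m_assoc[symmetric])
    qed
    then show ?thesis by (auto simp: Bij_def coset_action_def)
  qed
  show ?thesis
  proof (intro transitive_action.intro group_action.intro group_hom.intro group_hom_axioms.intro
      transitive_action_axioms.intro group_BijGroup is_group)
    show "coset_action G M \<in> hom G (BijGroup (coset_space G M))"
    proof (rule homI)
      fix g h assume gh: "g \<in> carrier G" "h \<in> carrier G"
      show "coset_action G M (g \<otimes> h) =
          coset_action G M g \<otimes>\<^bsub>BijGroup (coset_space G M)\<^esub> coset_action G M h"
      proof
        fix C
        show "coset_action G M (g \<otimes> h) C =
          (coset_action G M g \<otimes>\<^bsub>BijGroup (coset_space G M)\<^esub> coset_action G M h) C"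
        proof (cases "C \<in> coset_space G M")
          case True
          then show ?thesis using gh M Bij
            by (auto simp: coset_space_def BijGroup_def coset_action_coset m_assoc compose_def)
        next
          case False
          then show ?thesis using gh Bij
            by (auto simp: BijGroup_def compose_def coset_action_def)
        qed
      qed
    qed (use Bij in \<open>simp add: BijGroup_def\<close>)
    fix C D assume "C \<in> coset_space G M" "D \<in> coset_space G M"
    then obtain x y where "x \<in> carrier G" "y \<in> carrier G" "C = x <# M" "D = y <# M"
      by (auto simp: coset_space_def)
    then show "\<exists>g\<in>carrier G. coset_action G M g C = D"
      using M by (intro bexI[of _ "y \<otimes> inv x"]) (auto simp: coset_action_coset m_assoc)
  qed
qed

text \<open>
  The elements carrying the base coset into its own block of an invariant equivalence relation form
  a subgroup between the point stabilizer \<open>M\<close> and the whole group, and this subgroup determines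
  the relation.
\<close>

lemma coset_action_primitive:
  assumes M: "subgroup M G"
    and maximal: "\<And>L g. \<lbrakk>subgroup L G; M \<subseteq> L; g \<in> L; g \<notin> M\<rbrakk> \<Longrightarrow> L = carrier G"
  shows "primitive_action G (coset_space G M) (coset_action G M)"
proof -
  interpret transitive_action G "coset_space G M" "coset_action G M"
    by (rule coset_action_transitive[OF M])
  show ?thesis
  proof
    fix R
    assume eq: "equiv (coset_space G M) R"
      and invariant: "\<And>g x y. \<lbrakk>g \<in> carrier G; (x, y) \<in> R\<rbrakk> \<Longrightarrow>
        (coset_action G M g x, coset_action G M g y) \<in> R"
    have R: "R \<subseteq> coset_space G M \<times> coset_space G M"
      using eq by (auto simp: equiv_def refl_on_def)
    have refl: "(x <# M, x <# M) \<in> R" if "x \<in> carrier G" for x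
      using eq that coset_in_coset_space by (auto simp: equiv_def refl_on_def)
    have sym: "(y, x) \<in> R" if "(x, y) \<in> R" for x y
      using eq that by (auto simp: equiv_def sym_def)
    have trans: "(x, z) \<in> R" if "(x, y) \<in> R" "(y, z) \<in> R" for x y z
      using eq that by (auto simp: equiv_def trans_def)
    have inv': "((g \<otimes> x) <# M, (g \<otimes> y) <# M) \<in> R"
      if "g \<in> carrier G" "x \<in> carrier G" "y \<in> carrier G" "(x <# M, y <# M) \<in> R" for g x y
      using invariant[OF that(1,4)] that M by (simp add: coset_action_coset)
    define L where "L = {g \<in> carrier G. (\<one> <# M, g <# M) \<in> R}"
    have R_iff: "(x <# M, y <# M) \<in> R \<longleftrightarrow> inv x \<otimes> y \<in> L"
      if "x \<in> carrier G" "y \<in> carrier G" for x y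
      using inv'[of "inv x" x y] inv'[of x \<one> "inv x \<otimes> y"] that
      by (auto simp: L_def m_assoc[symmetric])
    have base: "M \<subseteq> L"
    proof
      fix m assume m: "m \<in> M"
      then have mc: "m \<in> carrier G" by (rule subgroup.mem_carrier[OF M])
      then have "m <# M = \<one> <# M" using lcos_eq_iff[OF M, of \<one> m] m by simp
      then show "m \<in> L" using mc refl[of \<one>] by (simp add: L_def)
    qed
    have L: "subgroup L G"
    proof (rule subgroup.intro)
      show "L \<subseteq> carrier G" "\<one> \<in> L" using refl by (auto simp: L_def)
      fix x assume x: "x \<in> L"
      then have xc: "x \<in> carrier G" by (simp add: L_def)
      show "inv x \<in> L"
        using x xc inv'[of "inv x" x \<one>] by (auto simp: L_def intro: sym)
      fix y assume y: "y \<in> L"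
      then have yc: "y \<in> carrier G" by (simp add: L_def)
      show "x \<otimes> y \<in> L"
        using x y xc yc inv'[of x \<one> y] by (auto simp: L_def intro: trans)
    qed
    show "R = Id_on (coset_space G M) \<or> R = coset_space G M \<times> coset_space G M"
    proof (cases "L \<subseteq> M")
      case True
      then have LM: "L = M" using base by simp
      have "R = Id_on (coset_space G M)"
      proof (rule Set.set_eqI)
        fix p :: "'a set \<times> 'a set"
        obtain C D where p: "p = (C, D)" by (cases p)
        show "p \<in> R \<longleftrightarrow> p \<in> Id_on (coset_space G M)"
        proof (cases "C \<in> coset_space G M \<and> D \<in> coset_space G M")
          case True
          then obtain x y where "x \<in> carrier G" "y \<in> carrier G" "C = x <# M" "D = y <# M"
            by (auto simp: coset_space_def)
          then show ?thesis
            using R_iff[of x y] lcos_eq_iff[OF M, of x y] LM True p by (auto simp: Id_on_def)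
        qed (use R p in auto)
      qed
      then show ?thesis ..
    next
      case False
      then have "L = carrier G" using maximal[OF L base] by auto
      then have "coset_space G M \<times> coset_space G M \<subseteq> R"
        using R_iff by (auto simp: coset_space_def)
      then show ?thesis using R by auto
    qed
  qed
qed

text \<open>
  An element carrying the pair \<open>(M, a M)\<close> to \<open>(M, b M)\<close> would lie in \<open>M\<close> and put \<open>b\<close> into \<open>M a M\<close>.
\<close>

lemma coset_action_not_two_transitive:
  assumes M: "subgroup M G" and ab: "a \<in> carrier G" "b \<in> carrier G" "a \<notin> M" "b \<notin> M"
    and double: "\<And>m m'. \<lbrakk>m \<in> M; m' \<in> M\<rbrakk> \<Longrightarrow> b \<noteq> m \<otimes> a \<otimes> m'"
  shows "\<not> two_transitive_action G (coset_space G M) (coset_action G M)"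
proof
  assume "two_transitive_action G (coset_space G M) (coset_action G M)"
  then interpret two_transitive_action G "coset_space G M" "coset_action G M" .
  have ne: "\<one> <# M \<noteq> c <# M" if "c \<in> carrier G" "c \<notin> M" for c
    using that lcos_eq_iff[OF M, of \<one> c] by simp
  obtain g where g: "g \<in> carrier G" "coset_action G M g (\<one> <# M) = \<one> <# M"
      "coset_action G M g (a <# M) = b <# M"
    using two_transitive[of "\<one> <# M" "a <# M" "\<one> <# M" "b <# M"] ne ab coset_in_coset_space
    by blast
  then have "\<one> <# M = g <# M" "(g \<otimes> a) <# M = b <# M"
    using M ab by (simp_all add: coset_action_coset)
  then have gM: "g \<in> M" and m': "inv (g \<otimes> a) \<otimes> b \<in> M"
    using M g ab lcos_eq_iff[of M] by auto
  have "b = g \<otimes> a \<otimes> (inv (g \<otimes> a) \<otimes> b)"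
    using g ab by (simp add: m_assoc[symmetric] r_inv)
  then show False using double[OF gM m'] by simp
qed

end

section \<open>Integer matrices modulo k\<close>

interpretation SL: group "SL n :: int mat monoid" for n
  by (rule group_SL)

lemma SL_mult [simp]: "x \<otimes>\<^bsub>SL n\<^esub> y = x * y"
  and SL_one [simp]: "\<one>\<^bsub>SL n\<^esub> = 1\<^sub>m n"
  by (simp_all add: SL_def)

lemma SL_carrier_mat: "g \<in> carrier (SL n) \<Longrightarrow> g \<in> carrier_mat n n"
  and SL_det: "g \<in> carrier (SL n) \<Longrightarrow> det g = 1"
  by (simp_all add: SL_def)

lemma SL_I: "g \<in> carrier_mat n n \<Longrightarrow> det g = 1 \<Longrightarrow> g \<in> carrier (SL n)"
  by (simp add: SL_def)

lemma SL_mult_closed: "g \<in> carrier (SL n) \<Longrightarrow> h \<in> carrier (SL n) \<Longrightarrow> g * h \<in> carrier (SL n)"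
  and SL_assoc: "f \<in> carrier (SL n) \<Longrightarrow> g \<in> carrier (SL n) \<Longrightarrow> h \<in> carrier (SL n) \<Longrightarrow>
    f * g * h = f * (g * h)"
  and SL_one_closed: "1\<^sub>m n \<in> carrier (SL n :: int mat monoid)"
  and SL_l_one: "g \<in> carrier (SL n) \<Longrightarrow> 1\<^sub>m n * g = g"
  and SL_r_one: "g \<in> carrier (SL n) \<Longrightarrow> g * 1\<^sub>m n = g"
  and SL_l_inv: "g \<in> carrier (SL n) \<Longrightarrow> inv\<^bsub>SL n\<^esub> g * g = 1\<^sub>m n"
  and SL_r_inv: "g \<in> carrier (SL n) \<Longrightarrow> g * inv\<^bsub>SL n\<^esub> g = 1\<^sub>m n"
  for f g h :: "int mat"
  using SL.m_closed[of g n h] SL.m_assoc[of f n g h] SL.one_closed[of n] SL.l_one[of g n] SL.r_one[of g n]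
    SL.l_inv[of g n] SL.r_inv[of g n] by simp_all

lemma mult_entry:
  assumes "A \<in> carrier_mat n n" "B \<in> carrier_mat n n" "i < n" "j < n"
  shows "(A * B) $$ (i, j) = (\<Sum>l<n. A $$ (i, l) * B $$ (l, j))"
  using assms by (auto simp: scalar_prod_def atLeast0LessThan intro!: sum.cong)

definition mat_cong :: "nat \<Rightarrow> int \<Rightarrow> int mat \<Rightarrow> int mat \<Rightarrow> bool" where
  "mat_cong n k A B \<longleftrightarrow> (\<forall>i<n. \<forall>j<n. [A $$ (i, j) = B $$ (i, j)] (mod k))"

lemma mat_cong_refl: "mat_cong n k A A"
  by (simp add: mat_cong_def)

lemma mat_cong_sym: "mat_cong n k A B \<Longrightarrow> mat_cong n k B A"
  by (simp add: mat_cong_def cong_sym)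

lemma mat_cong_trans: "mat_cong n k A B \<Longrightarrow> mat_cong n k B C \<Longrightarrow> mat_cong n k A C"
  unfolding mat_cong_def by (meson cong_trans)

lemma mat_cong_mult:
  assumes "mat_cong n k A A'" "mat_cong n k B B'"
    and "A \<in> carrier (SL n)" "A' \<in> carrier (SL n)" "B \<in> carrier (SL n)" "B' \<in> carrier (SL n)"
  shows "mat_cong n k (A * B) (A' * B')"
  unfolding mat_cong_def
proof (intro allI impI)
  fix i j assume ij: "i < n" "j < n"
  have "[(\<Sum>l<n. A $$ (i, l) * B $$ (l, j)) = (\<Sum>l<n. A' $$ (i, l) * B' $$ (l, j))] (mod k)"
    using assms(1,2) ij by (intro cong_sum cong_mult) (simp_all add: mat_cong_def)
  then show "[(A * B) $$ (i, j) = (A' * B') $$ (i, j)] (mod k)"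
    by (simp only: mult_entry[OF assms(3)[THEN SL_carrier_mat] assms(5)[THEN SL_carrier_mat] ij]
        mult_entry[OF assms(4)[THEN SL_carrier_mat] assms(6)[THEN SL_carrier_mat] ij])
qed

lemma mat_cong_mult_cancel:
  assumes x: "x \<in> carrier (SL n)" and y: "y \<in> carrier (SL n)" and xy: "mat_cong n k (x * y) x"
  shows "mat_cong n k y (1\<^sub>m n)"
proof -
  let ?i = "inv\<^bsub>SL n\<^esub> x"
  have ic: "?i \<in> carrier (SL n)" using x by (rule SL.inv_closed)
  have "mat_cong n k (?i * (x * y)) (?i * x)"
    by (rule mat_cong_mult[OF mat_cong_refl xy ic ic SL_mult_closed[OF x y] x])
  then show ?thesis
    by (simp only: SL_assoc[OF ic x y, symmetric] SL_l_inv[OF x] SL_l_one[OF y])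
qed

lemma SL_column_not_divisible:
  assumes g: "g \<in> carrier (SL n)" and "j < n" and "\<not> is_unit (k::int)"
  obtains i where "i < n" "\<not> k dvd g $$ (i, j)"
proof (rule ccontr)
  note witness = that
  assume none: "\<not> thesis"
  have dvd: "k dvd g $$ (i, j)" if "i < n" for i
    using none witness that by blast
  have "(inv\<^bsub>SL n\<^esub> g * g) $$ (j, j) = 1"
    using assms(2) by (simp add: SL_l_inv[OF g])
  moreover have "k dvd (inv\<^bsub>SL n\<^esub> g * g) $$ (j, j)"
    using assms(2) SL_carrier_mat[OF g] SL_carrier_mat[OF SL.inv_closed[OF g]]
    by (auto simp: mult_entry simp del: index_mult_mat intro!: dvd_sum dvd_mult dvd)
  ultimately show False using assms(3) by simp
qed

definition congruence_subgroup :: "nat \<Rightarrow> int \<Rightarrow> int mat set" where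
  "congruence_subgroup n k = {g \<in> carrier (SL n). mat_cong n k g (1\<^sub>m n)}"

lemma congruent_to_member:
  assumes L: "subgroup L (SL n)" and Gam: "congruence_subgroup n k \<subseteq> L"
    and g: "g \<in> L" and h: "h \<in> carrier (SL n)" and gh: "mat_cong n k h g"
  shows "h \<in> L"
proof -
  have gc: "g \<in> carrier (SL n)" using subgroup.mem_carrier[OF L g] .
  let ?i = "inv\<^bsub>SL n\<^esub> g"
  have ic: "?i \<in> carrier (SL n)" using gc by simp
  have "mat_cong n k (h * ?i) (g * ?i)"
    by (rule mat_cong_mult[OF gh mat_cong_refl h gc ic ic])
  then have "h * ?i \<in> congruence_subgroup n k"
    using SL_mult_closed[OF h ic] by (simp add: congruence_subgroup_def SL_r_inv[OF gc])
  then have "h * ?i * g \<in> L"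
    using Gam subgroup.m_closed[OF L _ g, of "h * ?i"] by auto
  moreover have "h * ?i * g = h"
    by (simp only: SL_assoc[OF h ic gc] SL_l_inv[OF gc] SL_r_one[OF h])
  ultimately show ?thesis by simp
qed

text \<open>The residues modulo \<open>k\<close> of the powers of \<open>g\<close> take finitely many values, so two of them agree.\<close>

lemma SL_power_congruent_one:
  assumes g: "g \<in> carrier (SL n)" and k: "k > 0"
  obtains d :: nat where "mat_cong n k (g [^]\<^bsub>SL n\<^esub> Suc d) (1\<^sub>m n)"
proof -
  define red where "red h = restrict (\<lambda>(i, j). h $$ (i, j) mod k) ({..<n} \<times> {..<n})"
    for h :: "int mat"
  let ?P = "\<lambda>a::nat. g [^]\<^bsub>SL n\<^esub> a"
  have "range (red \<circ> ?P) \<subseteq> (\<Pi>\<^sub>E _ \<in> {..<n} \<times> {..<n}. {0..<k})"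
    using k by (auto simp: red_def PiE_def)
  moreover have "finite (\<Pi>\<^sub>E _ \<in> {..<n} \<times> {..<n}. {0..<k})"
    by (intro finite_PiE) auto
  ultimately have "finite (range (red \<circ> ?P))" by (rule finite_subset)
  then have "\<not> inj (red \<circ> ?P)" using finite_imageD infinite_UNIV_nat by blast
  then obtain a b where ab: "a \<noteq> b" "red (?P a) = red (?P b)"
    by (auto simp: inj_def)
  obtain c d where cd: "red (?P c) = red (?P (c + Suc d))"
  proof (cases a b rule: linorder_cases)
    case less
    then show ?thesis using ab that[of a "b - Suc a"] by simp
  next
    case greater
    then show ?thesis using ab that[of b "a - Suc b"] by simp
  qed (use ab in simp)
  have cong: "mat_cong n k (?P (c + Suc d)) (?P c)"
    unfolding mat_cong_def
  proof (intro allI impI)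
    fix i j assume "i < n" "j < n"
    then show "[?P (c + Suc d) $$ (i, j) = ?P c $$ (i, j)] (mod k)"
      using fun_cong[OF cd, of "(i, j)"] by (simp add: red_def cong_def)
  qed
  have "?P (c + Suc d) = ?P c * ?P (Suc d)"
    using SL.nat_pow_mult[OF g, of c "Suc d"] by (simp del: SL.nat_pow_Suc)
  then have "mat_cong n k (?P c * ?P (Suc d)) (?P c)"
    using cong by metis
  from mat_cong_mult_cancel[OF SL.nat_pow_closed[OF g] SL.nat_pow_closed[OF g] this]
  show ?thesis by (rule that)
qed

text \<open>
  Modulo \<open>k\<close> every element has finite order, so its inverse is a power of it times an element of
  the congruence subgroup, and closure under products implies closure under inverses.
\<close>

lemma subgroup_containing_congruence_subgroup:
  assumes k: "k > 0" and sub: "L \<subseteq> carrier (SL n)" and Gam: "congruence_subgroup n k \<subseteq> L"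
    and mult: "\<And>g h. g \<in> L \<Longrightarrow> h \<in> L \<Longrightarrow> g * h \<in> L"
  shows "subgroup L (SL n)"
proof (rule subgroup.intro)
  have one: "1\<^sub>m n \<in> L"
    using Gam SL.one_closed[of n] by (auto simp: congruence_subgroup_def mat_cong_refl)
  then show "\<one>\<^bsub>SL n\<^esub> \<in> L" by simp
  fix g assume gL: "g \<in> L"
  then have g: "g \<in> carrier (SL n)" using sub by auto
  let ?i = "inv\<^bsub>SL n\<^esub> g"
  have ic: "?i \<in> carrier (SL n)" using g by simp
  have pow: "g [^]\<^bsub>SL n\<^esub> (d::nat) \<in> L" for d
    by (induction d) (auto simp: one gL mult)
  obtain d :: nat where d: "mat_cong n k (g [^]\<^bsub>SL n\<^esub> Suc d) (1\<^sub>m n)"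
    using SL_power_congruent_one[OF g k] .
  let ?q = "g [^]\<^bsub>SL n\<^esub> Suc d"
  have qc: "?q \<in> carrier (SL n)" using g by (rule SL.nat_pow_closed)
  let ?r = "inv\<^bsub>SL n\<^esub> ?q"
  have rc: "?r \<in> carrier (SL n)" using qc by simp
  have "mat_cong n k (?q * ?r) (1\<^sub>m n * ?r)"
    by (rule mat_cong_mult[OF d mat_cong_refl qc SL_one_closed rc rc])
  then have "mat_cong n k ?r (1\<^sub>m n)"
    by (simp only: SL_r_inv[OF qc] SL_l_one[OF rc] mat_cong_sym)
  then have "?r \<in> L" using Gam rc by (auto simp: congruence_subgroup_def)
  \<comment> \<open>\<open>g\<^sup>-\<^sup>1 = g\<^sup>d (g\<^sup>d\<^sup>+\<^sup>1)\<^sup>-\<^sup>1\<close>\<close>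
  then have "g [^]\<^bsub>SL n\<^esub> d * ?r \<in> L" using pow mult by blast
  moreover have "g * (g [^]\<^bsub>SL n\<^esub> d * ?r) = 1\<^sub>m n"
  proof -
    have "g * (g [^]\<^bsub>SL n\<^esub> d * ?r) = g * g [^]\<^bsub>SL n\<^esub> d * ?r"
      by (rule SL_assoc[OF g SL.nat_pow_closed[OF g] rc, symmetric])
    also have "g * g [^]\<^bsub>SL n\<^esub> d = ?q" using SL.nat_pow_Suc2[OF g, of d] by simp
    finally show ?thesis by (simp only: SL_r_inv[OF qc])
  qed
  ultimately have "g [^]\<^bsub>SL n\<^esub> d * ?r \<in> L" "g * (g [^]\<^bsub>SL n\<^esub> d * ?r) = 1\<^sub>m n"
    by simp_all
  moreover from this have "?i = g [^]\<^bsub>SL n\<^esub> d * ?r"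
    using SL.inv_equality[OF SL.inv_comm[OF _ g]] g sub by auto
  ultimately show "?i \<in> L" by simp
qed (use sub mult in auto)

section \<open>Elementary matrices\<close>

abbreviation elem_mat :: "nat \<Rightarrow> nat \<Rightarrow> nat \<Rightarrow> int mat" where
  "elem_mat n i j \<equiv> addrow_mat n 1 i j"

lemma elem_SL: "i \<noteq> j \<Longrightarrow> addrow_mat n (a::int) i j \<in> carrier (SL n)"
  by (simp add: SL_I det_addrow_mat)

lemma elem_mult_entry:
  assumes "A \<in> carrier_mat n n" "i < n" "j < n" "r < n" "c < n"
  shows "(addrow_mat n (a::int) i j * A) $$ (r, c) = A $$ (r, c) + (if r = i then a * A $$ (j, c) else 0)"
  using assms by (simp add: addrow_mat[OF assms(1,3), symmetric] del: index_mult_mat)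

lemma mult_elem_entry:
  assumes "A \<in> carrier_mat n n" "i < n" "j < n" "r < n" "c < n"
  shows "(A * addrow_mat n (a::int) i j) $$ (r, c) = A $$ (r, c) + (if c = j then a * A $$ (r, i) else 0)"
  using assms by (simp add: addcol_mat[OF assms(1,2), symmetric] del: index_mult_mat)

lemma inv_elem:
  assumes "i < n" "j < n" "i \<noteq> j"
  shows "inv\<^bsub>SL n\<^esub> (addrow_mat n (a::int) i j) = addrow_mat n (- a) i j"
  using addrow_mat_inv[OF assms, of "- a"] assms elem_SL
  by (intro SL.inv_equality) auto

lemma elem_conj_entry:
  assumes A: "A \<in> carrier (SL n)" and ij: "i < n" "j < n" "i \<noteq> j" and rc: "r < n" "c < n"
  shows "(elem_mat n i j * A * inv\<^bsub>SL n\<^esub> (elem_mat n i j)) $$ (r, c) =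
    A $$ (r, c) + (if r = i then A $$ (j, c) else 0)
      - (if c = j then A $$ (r, i) + (if r = i then A $$ (j, i) else 0) else 0)"
proof -
  have Ac: "A \<in> carrier_mat n n" using A by (rule SL_carrier_mat)
  have EA: "elem_mat n i j * A \<in> carrier_mat n n" using Ac by auto
  show ?thesis
    unfolding inv_elem[OF ij] mult_elem_entry[OF EA ij(1,2) rc]
    using ij rc by (simp add: elem_mult_entry[OF Ac] del: index_mult_mat)
qed

text \<open>This is the Steinberg commutator relation between elementary matrices.\<close>

lemma elem_commutator_closed:
  assumes L: "subgroup L (SL n)" and ijk: "i < n" "j < n" "k < n" "i \<noteq> j" "j \<noteq> k" "i \<noteq> k"
    and ij: "elem_mat n i j \<in> L" and jk: "elem_mat n j k \<in> L"
  shows "elem_mat n i k \<in> L"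
proof -
  have eq: "elem_mat n i j * elem_mat n j k = elem_mat n i k * (elem_mat n j k * elem_mat n i j)"
  proof (rule eq_matI)
    fix r c assume "r < dim_row (elem_mat n i k * (elem_mat n j k * elem_mat n i j))"
      "c < dim_col (elem_mat n i k * (elem_mat n j k * elem_mat n i j))"
    then have rc: "r < n" "c < n" by auto
    have c: "elem_mat n j k * elem_mat n i j \<in> carrier_mat n n"
      by (rule mult_carrier_mat[OF addrow_mat_carrier addrow_mat_carrier])
    show "(elem_mat n i j * elem_mat n j k) $$ (r, c) = (elem_mat n i k * (elem_mat n j k * elem_mat n i j)) $$ (r, c)"
      using rc ijk
      by (simp add: elem_mult_entry[OF c] elem_mult_entry[OF addrow_mat_carrier] del: index_mult_mat)
  qed auto
  let ?q = "elem_mat n j k * elem_mat n i j"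
  have q: "?q \<in> L" using subgroup.m_closed[OF L jk ij] by simp
  have qc: "?q \<in> carrier (SL n)" using subgroup.mem_carrier[OF L q] .
  have ic: "inv\<^bsub>SL n\<^esub> ?q \<in> carrier (SL n)" using qc by (rule SL.inv_closed)
  have ik: "elem_mat n i k \<in> carrier (SL n)" using ijk(6) by (rule elem_SL)
  have "elem_mat n i j * elem_mat n j k * inv\<^bsub>SL n\<^esub> ?q \<in> L"
    using subgroup.m_closed[OF L subgroup.m_closed[OF L ij jk] subgroup.m_inv_closed[OF L q]] by simp
  then show ?thesis
    by (simp only: eq SL_assoc[OF ik qc ic] SL_r_inv[OF qc] SL_r_one[OF ik])
qed

lemma subgroup_cancel_left:
  fixes L :: "int mat set"
  assumes L: "subgroup L (SL n)" and e: "e \<in> L" and h: "h \<in> carrier (SL n)" and eh: "e * h \<in> L"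
  shows "h \<in> L"
proof -
  have ec: "e \<in> carrier (SL n)" using subgroup.mem_carrier[OF L e] .
  have "inv\<^bsub>SL n\<^esub> e * (e * h) \<in> L"
    using subgroup.m_closed[OF L subgroup.m_inv_closed[OF L e] eh] by simp
  then show ?thesis
    by (simp only: SL_assoc[OF SL.inv_closed[OF ec] ec h, symmetric] SL_l_inv[OF ec] SL_l_one[OF h])
qed

lemma cong_2_iff: "[a = b] (mod 2) \<longleftrightarrow> (odd a \<longleftrightarrow> odd b)" for a b :: int
  by (simp add: cong_iff_dvd_diff)

definition columns_cleared :: "nat \<Rightarrow> nat \<Rightarrow> int mat \<Rightarrow> bool" where
  "columns_cleared n k h \<longleftrightarrow> (\<forall>r<n. \<forall>c<k. odd (h $$ (r, c)) \<longleftrightarrow> r = c)"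

text \<open>
  If the column \<open>k\<close> were even from row \<open>k\<close> on, it would be a combination modulo 2 of the previous
  columns, which are unit vectors; multiplying by the inverse of \<open>h\<close> exposes the contradiction.
\<close>

lemma odd_pivot:
  assumes h: "h \<in> carrier (SL n)" and k: "k < n" and clear: "columns_cleared n k h"
  obtains i where "k \<le> i" "i < n" "odd (h $$ (i, k))"
proof (rule ccontr)
  note witness = that
  assume none: "\<not> thesis"
  have ev: "even (h $$ (i, k))" if "k \<le> i" "i < n" for i
    using none witness that by blast
  let ?f = "inv\<^bsub>SL n\<^esub> h"
  have hc: "h \<in> carrier_mat n n" and fc: "?f \<in> carrier_mat n n"
    using h SL.inv_closed[OF h] by (auto simp only: SL_carrier_mat)
  have prod: "(\<Sum>r<n. ?f $$ (k, r) * h $$ (r, l)) = (if k = l then 1 else 0)" if "l < n" for l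
    using mult_entry[OF fc hc k that] k that by (simp add: SL_l_inv[OF h])
  have "even (?f $$ (k, l))" if l: "l < k" for l
  proof -
    have "even (\<Sum>r\<in>{..<n} - {l}. ?f $$ (k, r) * h $$ (r, l))"
      using clear l by (intro dvd_sum) (auto simp: columns_cleared_def)
    moreover have "(\<Sum>r<n. ?f $$ (k, r) * h $$ (r, l)) = ?f $$ (k, l) * h $$ (l, l) +
        (\<Sum>r\<in>{..<n} - {l}. ?f $$ (k, r) * h $$ (r, l))"
      using l k by (intro sum.remove) auto
    moreover have "odd (h $$ (l, l))" using clear l k by (simp add: columns_cleared_def)
    moreover have "(\<Sum>r<n. ?f $$ (k, r) * h $$ (r, l)) = 0" using prod[of l] l k by simp
    ultimately have "?f $$ (k, l) * h $$ (l, l) =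
        - (\<Sum>r\<in>{..<n} - {l}. ?f $$ (k, r) * h $$ (r, l))"
      and "even (\<Sum>r\<in>{..<n} - {l}. ?f $$ (k, r) * h $$ (r, l))"
      by linarith+
    then have "even (?f $$ (k, l) * h $$ (l, l))" by simp
    with \<open>odd (h $$ (l, l))\<close> show ?thesis by simp
  qed
  then have "even (?f $$ (k, r) * h $$ (r, k))" if "r < n" for r
    using ev[of r] that by (cases "r < k") auto
  then have "even (\<Sum>r<n. ?f $$ (k, r) * h $$ (r, k))"
    by (intro dvd_sum) auto
  then show False using prod[of k] k by simp
qed

text \<open>
  Gaussian elimination modulo 2, with row additions as the only steps: over the field with two
  elements every nonzero pivot is 1. Membership in \<open>L\<close> is invariant under the steps, so it propagates
  downwards from the fully cleared matrices, which form the congruence subgroup.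
\<close>

lemma SL_generated_by_elem_mod_2:
  assumes L: "subgroup L (SL n)" and Gam: "congruence_subgroup n 2 \<subseteq> L"
    and elem: "\<And>i j. i < n \<Longrightarrow> j < n \<Longrightarrow> i \<noteq> j \<Longrightarrow> elem_mat n i j \<in> L"
  shows "L = carrier (SL n)"
proof -
  have "\<forall>h\<in>carrier (SL n). columns_cleared n k h \<longrightarrow> h \<in> L" if "k \<le> n" for k
    using that
  proof (induction rule: inc_induct)
    case base
    show ?case
      using Gam by (fastforce simp: columns_cleared_def congruence_subgroup_def mat_cong_def cong_2_iff)
  next
    case (step k)
    have kn: "k < n" using step.hyps by simp
    have add_row: "h \<in> L"
      if "h \<in> carrier (SL n)" "a < n" "b < n" "a \<noteq> b" "elem_mat n a b * h \<in> L" for h a b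
      using subgroup_cancel_left[OF L elem] that by blast
    have pivot: "\<forall>h\<in>carrier (SL n). columns_cleared n k h \<and> odd (h $$ (k, k)) \<and>
        (\<forall>a<m. a \<noteq> k \<longrightarrow> even (h $$ (a, k))) \<longrightarrow> h \<in> L" if "m \<le> n" for m
      using that
    proof (induction rule: inc_induct)
      case base
      show ?case
      proof (intro ballI impI)
        fix h assume "h \<in> carrier (SL n)" and *: "columns_cleared n k h \<and> odd (h $$ (k, k)) \<and>
          (\<forall>a<n. a \<noteq> k \<longrightarrow> even (h $$ (a, k)))"
        moreover have "columns_cleared n (Suc k) h"
          using * by (auto simp: columns_cleared_def less_Suc_eq)
        ultimately show "h \<in> L" using step.IH by blast
      qed
    next
      case (step m)
      show ?case
      proof (intro ballI impI)
        fix h assume h: "h \<in> carrier (SL n)" and *: "columns_cleared n k h \<and> odd (h $$ (k, k)) \<and>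
          (\<forall>a<m. a \<noteq> k \<longrightarrow> even (h $$ (a, k)))"
        show "h \<in> L"
        proof (cases "m = k \<or> even (h $$ (m, k))")
          case True
          then have "\<forall>a<Suc m. a \<noteq> k \<longrightarrow> even (h $$ (a, k))"
            using * by (auto simp: less_Suc_eq)
          then show ?thesis using step.IH h * by blast
        next
          case False
          have mn: "m < n" using step.hyps by simp
          let ?h = "elem_mat n m k * h"
          have hc: "?h \<in> carrier (SL n)" using False h elem_SL SL_mult_closed by blast
          have entry: "?h $$ (r, c) = h $$ (r, c) + (if r = m then h $$ (k, c) else 0)"
            if "r < n" "c < n" for r c
            using elem_mult_entry[OF SL_carrier_mat[OF h] mn kn that, of 1] by simp
          have "columns_cleared n k ?h"
            using * kn mn by (auto simp: columns_cleared_def entry simp del: index_mult_mat)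
          moreover have "odd (?h $$ (k, k))"
            using * kn False by (auto simp: entry simp del: index_mult_mat)
          moreover have "\<forall>a<Suc m. a \<noteq> k \<longrightarrow> even (?h $$ (a, k))"
            using * kn mn False by (auto simp: entry less_Suc_eq simp del: index_mult_mat)
          ultimately have "?h \<in> L" using step.IH hc by blast
          then show ?thesis using add_row[OF h mn kn] False by blast
        qed
      qed
    qed
    show ?case
    proof (intro ballI impI)
      fix h assume h: "h \<in> carrier (SL n)" and clear: "columns_cleared n k h"
      obtain i where i: "k \<le> i" "i < n" "odd (h $$ (i, k))"
        using odd_pivot[OF h kn clear] .
      show "h \<in> L"
      proof (cases "odd (h $$ (k, k))")
        case True
        then show ?thesis using pivot[of 0] h clear by simp
      next
        case False
        then have ki: "k < i" using i by (cases "k = i") auto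
        let ?h = "elem_mat n k i * h"
        have hc: "?h \<in> carrier (SL n)" using ki h elem_SL SL_mult_closed by (metis less_irrefl)
        have entry: "?h $$ (r, c) = h $$ (r, c) + (if r = k then h $$ (i, c) else 0)"
          if "r < n" "c < n" for r c
          using elem_mult_entry[OF SL_carrier_mat[OF h] kn i(2) that, of 1] by simp
        have "columns_cleared n k ?h" "odd (?h $$ (k, k))"
          using clear ki kn i False by (auto simp: columns_cleared_def entry simp del: index_mult_mat)
        then have "?h \<in> L" using pivot[of 0] hc by simp
        then show ?thesis using add_row[OF h kn i(2)] ki by blast
      qed
    qed
  qed
  from this[of 0] have "carrier (SL n) \<subseteq> L"
    by (auto simp: columns_cleared_def)
  then show ?thesis using subgroup.subset[OF L] by blast
qed

section \<open>The stabilizer of a plane modulo 2\<close>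

definition plane_stabilizer :: "nat \<Rightarrow> int mat set" where
  "plane_stabilizer n = {g \<in> carrier (SL n). \<forall>i j. 2 \<le> i \<longrightarrow> i < n \<longrightarrow> j < 2 \<longrightarrow> even (g $$ (i, j))}"

lemma congruence_subgroup_plane_stabilizer:
  "2 \<le> n \<Longrightarrow> congruence_subgroup n 2 \<subseteq> plane_stabilizer n"
  by (auto simp: congruence_subgroup_def plane_stabilizer_def mat_cong_def cong_2_iff)

lemma plane_stabilizer_subgroup:
  assumes n: "2 \<le> n"
  shows "subgroup (plane_stabilizer n) (SL n)"
proof (rule subgroup_containing_congruence_subgroup)
  show "congruence_subgroup n 2 \<subseteq> plane_stabilizer n"
    by (rule congruence_subgroup_plane_stabilizer[OF n])
  fix g h assume gh: "g \<in> plane_stabilizer n" "h \<in> plane_stabilizer n"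
  then have c: "g \<in> carrier (SL n)" "h \<in> carrier (SL n)" by (auto simp: plane_stabilizer_def)
  have "even ((g * h) $$ (i, j))" if ij: "2 \<le> i" "i < n" "j < 2" for i j
  proof -
    have "even (g $$ (i, l) * h $$ (l, j))" if "l < n" for l
      using gh ij that by (cases "l < 2") (auto simp: plane_stabilizer_def)
    moreover have "j < n" using ij n by simp
    ultimately show ?thesis
      by (simp only: mult_entry[OF c[THEN SL_carrier_mat] ij(2) \<open>j < n\<close>]) (auto intro: dvd_sum)
  qed
  then show "g * h \<in> plane_stabilizer n"
    using SL_mult_closed[OF c] by (simp add: plane_stabilizer_def del: index_mult_mat)
qed (auto simp: plane_stabilizer_def)

lemma elem_plane_stabilizer:
  assumes "2 \<le> n" "i < n" "j < n" "i \<noteq> j" "i < 2 \<or> 2 \<le> j"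
  shows "elem_mat n i j \<in> plane_stabilizer n"
  using assms elem_SL[of i j n 1] by (auto simp: plane_stabilizer_def)

lemma conj_elem_entry:
  assumes g: "g \<in> carrier (SL n)" and xy: "x < n" "y < n" and rc: "r < n" "c < n"
  shows "(g * elem_mat n x y * inv\<^bsub>SL n\<^esub> g) $$ (r, c) =
    (if r = c then 1 else 0) + g $$ (r, x) * (inv\<^bsub>SL n\<^esub> g) $$ (y, c)"
proof -
  let ?f = "inv\<^bsub>SL n\<^esub> g"
  have gc: "g \<in> carrier_mat n n" and fc: "?f \<in> carrier_mat n n"
    using g SL.inv_closed[OF g] by (auto simp only: SL_carrier_mat)
  have gE: "g * elem_mat n x y \<in> carrier_mat n n" using gc by auto
  have "(g * elem_mat n x y * ?f) $$ (r, c) = (\<Sum>l<n. (g * elem_mat n x y) $$ (r, l) * ?f $$ (l, c))"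
    by (rule mult_entry[OF gE fc rc])
  also have "\<dots> = (\<Sum>l<n. g $$ (r, l) * ?f $$ (l, c) + (if l = y then g $$ (r, x) * ?f $$ (y, c) else 0))"
  proof (rule sum.cong)
    fix l assume "l \<in> {..<n}"
    then show "(g * elem_mat n x y) $$ (r, l) * ?f $$ (l, c) =
        g $$ (r, l) * ?f $$ (l, c) + (if l = y then g $$ (r, x) * ?f $$ (y, c) else 0)"
      using mult_elem_entry[OF gc xy rc(1), of l 1] by (simp add: distrib_right del: index_mult_mat)
  qed simp
  also have "\<dots> = (g * ?f) $$ (r, c) + g $$ (r, x) * ?f $$ (y, c)"
    using xy by (simp add: sum.distrib mult_entry[OF gc fc rc] del: index_mult_mat)
  finally show ?thesis using rc by (simp add: SL_r_inv[OF g])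
qed

text \<open>The transvection is \<open>1 + u w\<^sup>T\<close>, known only up to congruence modulo 2.\<close>

definition contains_transvection :: "nat \<Rightarrow> int mat set \<Rightarrow> (nat \<Rightarrow> int) \<Rightarrow> (nat \<Rightarrow> int) \<Rightarrow> bool" where
  "contains_transvection n L u w \<longleftrightarrow>
    (\<exists>t\<in>L. \<forall>r<n. \<forall>c<n. odd (t $$ (r, c)) \<longleftrightarrow> odd ((if r = c then 1 else 0) + u r * w c))"

lemma contains_transvection_conj:
  assumes L: "subgroup L (SL n)" and t: "contains_transvection n L u w"
    and e: "elem_mat n a b \<in> L" and ab: "a < n" "b < n" "a \<noteq> b"
  shows "contains_transvection n L (u(a := u a + u b)) (w(b := w b - w a))"
proof -
  obtain t where tL: "t \<in> L"
    and t: "\<And>r c. r < n \<Longrightarrow> c < n \<Longrightarrow> odd (t $$ (r, c)) \<longleftrightarrow> odd ((if r = c then 1 else 0) + u r * w c)"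
    using t by (auto simp: contains_transvection_def)
  let ?t = "elem_mat n a b * t * inv\<^bsub>SL n\<^esub> (elem_mat n a b)"
  have "?t \<in> L"
    using subgroup.m_closed[OF L subgroup.m_closed[OF L e tL] subgroup.m_inv_closed[OF L e]] by simp
  moreover have "odd (?t $$ (r, c)) \<longleftrightarrow> odd ((if r = c then 1 else 0) +
      (u(a := u a + u b)) r * (w(b := w b - w a)) c)" if rc: "r < n" "c < n" for r c
  proof -
    define T where "T r c = (if r = c then 1 else 0) + u r * w c" for r c
    have tT: "even (t $$ (r, c)) \<longleftrightarrow> even (T r c)" if "r < n" "c < n" for r c
      using t[OF that] unfolding T_def by blast
    have "odd (?t $$ (r, c)) \<longleftrightarrow> odd (T r c + (if r = a then T b c else 0)
        - (if c = b then T r a + (if r = a then T b a else 0) else 0))"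
      unfolding elem_conj_entry[OF subgroup.mem_carrier[OF L tL] ab rc]
      using ab rc by (simp add: tT)
    also have "T r c + (if r = a then T b c else 0)
        - (if c = b then T r a + (if r = a then T b a else 0) else 0) =
        (if r = c then 1 else 0) + (u(a := u a + u b)) r * (w(b := w b - w a)) c"
      using ab(3) by (simp add: T_def algebra_simps)
    finally show ?thesis .
  qed
  ultimately show ?thesis unfolding contains_transvection_def by blast
qed

text \<open>
  Conjugating by row and column additions that stabilize the plane turns the column \<open>u\<close> into the
  \<open>i\<close>-th unit vector and then the row \<open>w\<close> into the \<open>j\<close>-th one.
\<close>

lemma transvection_imp_elem:
  assumes n: "2 \<le> n" and L: "subgroup L (SL n)" and PL: "plane_stabilizer n \<subseteq> L"
    and t: "contains_transvection n L u w"
    and i: "2 \<le> i" "i < n" "odd (u i)" and j: "j < 2" "odd (w j)"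
  shows "elem_mat n i j \<in> L"
proof -
  have jn: "j < n" and ij: "i \<noteq> j" using i j n by auto
  have Gam: "congruence_subgroup n 2 \<subseteq> L"
    using congruence_subgroup_plane_stabilizer[OF n] PL by blast
  have row: "\<forall>u w. contains_transvection n L u w \<and> odd (u i) \<and> odd (w j) \<and>
      (\<forall>a<n. a \<noteq> i \<longrightarrow> even (u a)) \<and> (\<forall>b<m. b \<noteq> j \<longrightarrow> even (w b)) \<longrightarrow> elem_mat n i j \<in> L"
    if "m \<le> n" for m
    using that
  proof (induction rule: inc_induct)
    case base
    show ?case
    proof (intro allI impI, elim conjE)
      fix u w assume "contains_transvection n L u w" and uw: "odd (u i)" "odd (w j)"
        "\<forall>a<n. a \<noteq> i \<longrightarrow> even (u a)" "\<forall>b<n. b \<noteq> j \<longrightarrow> even (w b)"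
      then obtain t where tL: "t \<in> L" and t: "\<forall>r<n. \<forall>c<n. odd (t $$ (r, c)) \<longleftrightarrow>
          odd ((if r = c then 1 else 0) + u r * w c)"
        by (auto simp: contains_transvection_def)
      have "mat_cong n 2 (elem_mat n i j) t"
        unfolding mat_cong_def cong_2_iff using t uw ij by auto
      then show "elem_mat n i j \<in> L"
        using congruent_to_member[OF L Gam tL elem_SL[OF ij]] by simp
    qed
  next
    case (step m)
    show ?case
    proof (intro allI impI, elim conjE)
      fix u w assume cont: "contains_transvection n L u w" and uw: "odd (u i)" "odd (w j)"
        "\<forall>a<n. a \<noteq> i \<longrightarrow> even (u a)" "\<forall>b<m. b \<noteq> j \<longrightarrow> even (w b)"
      have mn: "m < n" using step.hyps by simp
      consider "m = j \<or> even (w m)" | "m = i" "odd (w m)" | "m \<noteq> j" "m \<noteq> i" "odd (w m)" by blast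
      then show "elem_mat n i j \<in> L"
      proof cases
        case 1
        then have "\<forall>b<Suc m. b \<noteq> j \<longrightarrow> even (w b)" using uw by (auto simp: less_Suc_eq)
        then show ?thesis using step.IH cont uw by blast
      next
        \<comment> \<open>Here \<open>w \<bullet> u\<close> would be odd and \<open>1 + u w\<^sup>T\<close> would kill \<open>u\<close> modulo 2.\<close>
        case 2
        obtain t where tL: "t \<in> L" and t: "\<forall>r<n. \<forall>c<n. odd (t $$ (r, c)) \<longleftrightarrow>
            odd ((if r = c then 1 else 0) + u r * w c)"
          using cont by (auto simp: contains_transvection_def)
        obtain r where "r < n" "odd (t $$ (r, i))"
          using SL_column_not_divisible[OF subgroup.mem_carrier[OF L tL] i(2), of 2] by auto
        then show ?thesis using t uw 2 i by (cases "r = i") auto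
      next
        case 3
        have "elem_mat n j m \<in> L"
          using elem_plane_stabilizer[OF n jn mn] 3 j PL by auto
        then have "contains_transvection n L (u(j := u j + u m)) (w(m := w m - w j))"
          using contains_transvection_conj[OF L cont _ jn mn] 3 by auto
        moreover have "odd ((u(j := u j + u m)) i)" "odd ((w(m := w m - w j)) j)"
          "\<forall>a<n. a \<noteq> i \<longrightarrow> even ((u(j := u j + u m)) a)"
          "\<forall>b<Suc m. b \<noteq> j \<longrightarrow> even ((w(m := w m - w j)) b)"
          using uw 3 ij jn mn by (auto simp: less_Suc_eq)
        ultimately show ?thesis using step.IH by blast
      qed
    qed
  qed
  have "\<forall>u w. contains_transvection n L u w \<and> odd (u i) \<and> odd (w j) \<and>
      (\<forall>a<m. a \<noteq> i \<longrightarrow> even (u a)) \<longrightarrow> elem_mat n i j \<in> L" if "m \<le> n" for m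
    using that
  proof (induction rule: inc_induct)
    case base
    show ?case using row[of 0] by simp
  next
    case (step m)
    show ?case
    proof (intro allI impI, elim conjE)
      fix u w assume cont: "contains_transvection n L u w" and uw: "odd (u i)" "odd (w j)"
        "\<forall>a<m. a \<noteq> i \<longrightarrow> even (u a)"
      have mn: "m < n" using step.hyps by simp
      show "elem_mat n i j \<in> L"
      proof (cases "m = i \<or> even (u m)")
        case True
        then have "\<forall>a<Suc m. a \<noteq> i \<longrightarrow> even (u a)" using uw by (auto simp: less_Suc_eq)
        then show ?thesis using step.IH cont uw by blast
      next
        case False
        have "elem_mat n m i \<in> L"
          using elem_plane_stabilizer[OF n mn i(2)] False i PL by auto
        then have "contains_transvection n L (u(m := u m + u i)) (w(i := w i - w m))"
          using contains_transvection_conj[OF L cont _ mn i(2)] False by auto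
        moreover have "odd ((u(m := u m + u i)) i)" "odd ((w(i := w i - w m)) j)"
          "\<forall>a<Suc m. a \<noteq> i \<longrightarrow> even ((u(m := u m + u i)) a)"
          using uw False ij by (auto simp: less_Suc_eq)
        ultimately show ?thesis using step.IH by blast
      qed
    qed
  qed
  from this[of 0] show ?thesis using t i j by auto
qed

text \<open>
  A conjugate \<open>g (1 + e\<^sub>x e\<^sub>y\<^sup>T) g\<^sup>-\<^sup>1 = 1 + (g e\<^sub>x) (e\<^sub>y\<^sup>T g\<^sup>-\<^sup>1)\<close> of an element of the unipotent
  radical is a transvection whose centre \<open>g e\<^sub>x\<close> can be chosen outside the plane and whose axis can be
  chosen not to contain it, because neither \<open>g\<close> nor \<open>g\<^sup>-\<^sup>1\<close> preserves the plane.
\<close>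

lemma plane_stabilizer_maximal:
  assumes n: "2 \<le> n" and L: "subgroup L (SL n)" and PL: "plane_stabilizer n \<subseteq> L"
    and g: "g \<in> L" "g \<notin> plane_stabilizer n"
  shows "L = carrier (SL n)"
proof -
  let ?f = "inv\<^bsub>SL n\<^esub> g"
  have gc: "g \<in> carrier (SL n)" using subgroup.mem_carrier[OF L g(1)] .
  have fL: "?f \<in> L" using subgroup.m_inv_closed[OF L g(1)] .
  have fP: "?f \<notin> plane_stabilizer n"
    using subgroup.m_inv_closed[OF plane_stabilizer_subgroup[OF n], of ?f] g gc by auto
  obtain i x where ix: "2 \<le> i" "i < n" "x < 2" "odd (g $$ (i, x))"
    using g gc by (auto simp: plane_stabilizer_def)
  obtain y j where yj: "2 \<le> y" "y < n" "j < 2" "odd (?f $$ (y, j))"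
    using fP SL.inv_closed[OF gc] by (auto simp: plane_stabilizer_def)
  have xn: "x < n" and jn: "j < n" and ij: "i \<noteq> j" using ix yj n by auto
  have "elem_mat n x y \<in> L"
    using elem_plane_stabilizer[OF n xn yj(2)] ix yj PL by auto
  then have "g * elem_mat n x y * ?f \<in> L"
    using subgroup.m_closed[OF L subgroup.m_closed[OF L g(1)] fL] by simp
  then have "contains_transvection n L (\<lambda>r. g $$ (r, x)) (\<lambda>c. ?f $$ (y, c))"
    unfolding contains_transvection_def using conj_elem_entry[OF gc xn yj(2)] by (intro bexI) auto
  then have Eij: "elem_mat n i j \<in> L"
    using transvection_imp_elem[OF n L PL _ ix(1,2) _ yj(3)] ix yj by blast
  have "elem_mat n a b \<in> L" if ab: "a < n" "b < n" "a \<noteq> b" for a b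
  proof (cases "a < 2 \<or> 2 \<le> b")
    case True
    then show ?thesis using elem_plane_stabilizer[OF n ab] PL by blast
  next
    case False
    have Eaj: "elem_mat n a j \<in> L"
    proof (cases "a = i")
      case False
      have "elem_mat n a i \<in> L"
        using elem_plane_stabilizer[OF n ab(1) ix(2) False] ix PL by blast
      then show ?thesis
        using elem_commutator_closed[OF L ab(1) ix(2) jn False ij _ _ Eij]
          \<open>\<not> (a < 2 \<or> 2 \<le> b)\<close> yj by auto
    qed (use Eij in simp)
    show ?thesis
    proof (cases "b = j")
      case bj: False
      have "elem_mat n j b \<in> L"
        using elem_plane_stabilizer[OF n jn ab(2)] bj yj PL by auto
      then show ?thesis
        using elem_commutator_closed[OF L ab(1) jn ab(2) _ _ ab(3) Eaj] bj False yj by auto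
    qed (use Eaj in simp)
  qed
  moreover have "congruence_subgroup n 2 \<subseteq> L"
    using congruence_subgroup_plane_stabilizer[OF n] PL by blast
  ultimately show ?thesis using SL_generated_by_elem_mod_2[OF L] by blast
qed

text \<open>
  The matrix \<open>a\<close> maps the plane to one meeting it in a line, and \<open>b\<close> maps it to one meeting it
  trivially. Correspondingly the lower left block of \<open>m a m'\<close> has rank 1 modulo 2, that of \<open>b\<close> has rank 2.
\<close>

lemma primitive_not_two_transitive_dim_ge_4:
  assumes n: "4 \<le> n"
  shows "\<exists>(X :: int mat set set) \<phi>.
    primitive_action (SL n :: int mat monoid) X \<phi> \<and>
    \<not> two_transitive_action (SL n :: int mat monoid) X \<phi>"
proof -
  let ?P = "plane_stabilizer n" and ?a = "elem_mat n 2 0" and ?b = "elem_mat n 2 0 * elem_mat n 3 1"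
  have n2: "2 \<le> n" using n by simp
  note P = plane_stabilizer_subgroup[OF n2]
  have ac: "?a \<in> carrier (SL n)" and bc: "?b \<in> carrier (SL n)"
    using elem_SL SL_mult_closed by auto
  have b_entry: "?b $$ (r, c) = elem_mat n 3 1 $$ (r, c) + (if r = 2 then elem_mat n 3 1 $$ (0, c) else 0)"
    if "r < n" "c < n" for r c
    using elem_mult_entry[of "elem_mat n 3 1" n 2 0 r c 1] that n by (simp del: index_mult_mat)
  have b: "odd (?b $$ (2, 0))" "odd (?b $$ (3, 1))" "even (?b $$ (2, 1))" "even (?b $$ (3, 0))"
    using n b_entry[of 2 0] b_entry[of 3 1] b_entry[of 2 1] b_entry[of 3 0]
    by (simp_all del: index_mult_mat)
  have aP: "?a \<notin> ?P" using n by (auto simp: plane_stabilizer_def intro!: exI[of _ 2] exI[of _ 0])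
  have bP: "?b \<notin> ?P"
  proof
    assume "?b \<in> ?P"
    then have "even (?b $$ (2, 0))" using n unfolding plane_stabilizer_def by fastforce
    then show False using b by blast
  qed
  have "?b \<noteq> m * ?a * m'" if m: "m \<in> ?P" "m' \<in> ?P" for m m'
  proof
    assume eq: "?b = m * ?a * m'"
    have mc: "m \<in> carrier_mat n n" "m' \<in> carrier_mat n n"
      using m by (auto simp: plane_stabilizer_def SL_carrier_mat)
    have mac: "m * ?a \<in> carrier_mat n n" using mc by auto
    have "odd (?b $$ (i, j)) \<longleftrightarrow> odd (m $$ (i, 2) * m' $$ (0, j))"
      if ij: "2 \<le> i" "i < n" "j < 2" for i j
    proof -
      have jn: "j < n" using ij n by simp
      have "?b $$ (i, j) = (\<Sum>l<n. (m * ?a) $$ (i, l) * m' $$ (l, j))"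
        unfolding eq by (rule mult_entry[OF mac mc(2) ij(2) jn])
      also have "\<dots> = (\<Sum>l<n. m $$ (i, l) * m' $$ (l, j) + (if l = 0 then m $$ (i, 2) * m' $$ (0, j) else 0))"
      proof (rule sum.cong)
        fix l assume "l \<in> {..<n}"
        then show "(m * ?a) $$ (i, l) * m' $$ (l, j) =
          m $$ (i, l) * m' $$ (l, j) + (if l = 0 then m $$ (i, 2) * m' $$ (0, j) else 0)"
          using mult_elem_entry[OF mc(1) _ _ ij(2), of 2 0 l 1] n
          by (simp add: distrib_right del: index_mult_mat)
      qed simp
      also have "\<dots> = (\<Sum>l<n. m $$ (i, l) * m' $$ (l, j)) + m $$ (i, 2) * m' $$ (0, j)"
        using n by (simp add: sum.distrib)
      finally have "?b $$ (i, j) = \<dots>" .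
      moreover have "even (\<Sum>l<n. m $$ (i, l) * m' $$ (l, j))"
      proof (rule dvd_sum)
        fix l assume "l \<in> {..<n}"
        then show "even (m $$ (i, l) * m' $$ (l, j))"
          using m ij by (cases "l < 2") (auto simp: plane_stabilizer_def)
      qed
      ultimately show ?thesis by simp
    qed
    from this[of 2 0] this[of 3 1] this[of 2 1] show False using b n by simp
  qed
  then have "\<not> two_transitive_action (SL n) (coset_space (SL n) ?P) (coset_action (SL n) ?P)"
    by (intro SL.coset_action_not_two_transitive[OF P ac bc aP bP]) simp
  moreover have "primitive_action (SL n) (coset_space (SL n) ?P) (coset_action (SL n) ?P)"
    by (rule SL.coset_action_primitive[OF P]) (rule plane_stabilizer_maximal[OF n2])
  ultimately show ?thesis by blast
qed

section \<open>Overgroups of a complement modulo 4\<close>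

text \<open>
  Since \<open>(1 + 2 A) (1 + 2 B) \<equiv> 1 + 2 (A + B)\<close> modulo 4, the map \<open>1 + 2 A \<mapsto> A\<close> identifies the kernel of
  reduction modulo 2 in \<open>SL(n, \<int>/4)\<close> with an additive group of matrices modulo 2. The matrices \<open>f\<close>
  below are the image of \<open>L\<close> under this identification.
\<close>

definition realizes :: "nat \<Rightarrow> int mat set \<Rightarrow> (nat \<Rightarrow> nat \<Rightarrow> int) \<Rightarrow> bool" where
  "realizes n L f \<longleftrightarrow>
    (\<exists>k\<in>L. \<forall>r<n. \<forall>c<n. [k $$ (r, c) = (if r = c then 1 else 0) + 2 * f r c] (mod 4))"

lemma mult_near_one:
  fixes f g :: "nat \<Rightarrow> nat \<Rightarrow> int"
  assumes k: "k \<in> carrier (SL n)" "\<And>r c. r < n \<Longrightarrow> c < n \<Longrightarrow>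
      [k $$ (r, c) = (if r = c then 1 else 0) + 2 * f r c] (mod 4)"
    and l: "l \<in> carrier (SL n)" "\<And>r c. r < n \<Longrightarrow> c < n \<Longrightarrow>
      [l $$ (r, c) = (if r = c then 1 else 0) + 2 * g r c] (mod 4)"
    and rc: "r < n" "c < n"
  shows "[(k * l) $$ (r, c) = (if r = c then 1 else 0) + 2 * (f r c + g r c)] (mod 4)"
proof -
  let ?d = "\<lambda>a b. if a = b then 1 else 0 :: int"
  have prod: "(k * l) $$ (r, c) = (\<Sum>a<n. k $$ (r, a) * l $$ (a, c))"
    by (rule mult_entry[OF SL_carrier_mat[OF k(1)] SL_carrier_mat[OF l(1)] rc])
  have "[(\<Sum>a<n. k $$ (r, a) * l $$ (a, c)) =
      (\<Sum>a<n. (?d r a + 2 * f r a) * (?d a c + 2 * g a c))] (mod 4)"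
    using rc by (intro cong_sum cong_mult k(2) l(2)) auto
  also have "(\<Sum>a<n. (?d r a + 2 * f r a) * (?d a c + 2 * g a c)) =
      (\<Sum>a<n. (if a = r then ?d r c + 2 * g r c else 0) + (if a = c then 2 * f r c else 0)
        + 4 * (f r a * g a c))"
    by (rule sum.cong) (auto simp: algebra_simps)
  also have "\<dots> = ?d r c + 2 * (f r c + g r c) + 4 * (\<Sum>a<n. f r a * g a c)"
    using rc by (simp add: sum.distrib sum_distrib_left)
  also have "[\<dots> = ?d r c + 2 * (f r c + g r c)] (mod 4)"
    by (simp add: cong_iff_dvd_diff)
  finally show ?thesis unfolding prod .
qed

lemma near_one_expand:
  assumes "mat_cong n 2 k (1\<^sub>m n)"
  shows "\<exists>f. \<forall>r<n. \<forall>c<n. k $$ (r, c) = (if r = c then 1 else 0) + 2 * f r c"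
proof -
  define f where "f r c = (k $$ (r, c) - (if r = c then 1 else 0)) div 2" for r c
  have "k $$ (r, c) = (if r = c then 1 else 0) + 2 * f r c" if "r < n" "c < n" for r c
  proof -
    have "2 dvd k $$ (r, c) - (if r = c then 1 else 0)"
      using assms that by (auto simp: mat_cong_def cong_iff_dvd_diff)
    then show ?thesis by (simp add: f_def)
  qed
  then show ?thesis by blast
qed

lemma near_one_commute:
  assumes k: "k \<in> carrier (SL n)" "mat_cong n 2 k (1\<^sub>m n)"
    and l: "l \<in> carrier (SL n)" "mat_cong n 2 l (1\<^sub>m n)"
  shows "mat_cong n 4 (k * l) (l * k)"
proof -
  obtain f where f: "\<And>r c. r < n \<Longrightarrow> c < n \<Longrightarrow> k $$ (r, c) = (if r = c then 1 else 0) + 2 * f r c"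
    using near_one_expand[OF k(2)] by blast
  obtain g where g: "\<And>r c. r < n \<Longrightarrow> c < n \<Longrightarrow> l $$ (r, c) = (if r = c then 1 else 0) + 2 * g r c"
    using near_one_expand[OF l(2)] by blast
  show ?thesis
    unfolding mat_cong_def
  proof (intro allI impI)
    fix r c assume rc: "r < n" "c < n"
    let ?y = "(if r = c then 1 else 0) + 2 * (f r c + g r c)"
    have "[(k * l) $$ (r, c) = ?y] (mod 4)"
      by (rule mult_near_one[OF k(1) _ l(1) _ rc]) (simp_all add: f g)
    also have "[?y = (l * k) $$ (r, c)] (mod 4)"
    proof (rule cong_sym)
      have "[(l * k) $$ (r, c) = (if r = c then 1 else 0) + 2 * (g r c + f r c)] (mod 4)"
        by (rule mult_near_one[OF l(1) _ k(1) _ rc]) (simp_all add: f g)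
      then show "[(l * k) $$ (r, c) = ?y] (mod 4)" by (simp only: add.commute)
    qed
    finally show "[(k * l) $$ (r, c) = (l * k) $$ (r, c)] (mod 4)" .
  qed
qed

definition matrix_unit :: "nat \<Rightarrow> nat \<Rightarrow> nat \<Rightarrow> nat \<Rightarrow> int" where
  "matrix_unit i j r c = (if r = i \<and> c = j then 1 else 0)"

text \<open>
  The last assumption says that \<open>L\<close> surjects onto \<open>SL(n, \<int>/2)\<close>: the elementary matrices generate the
  latter.
\<close>

locale elementary_mod_2 =
  fixes n :: nat and L :: "int mat set"
  assumes L: "subgroup L (SL n)"
    and Gam: "congruence_subgroup n 4 \<subseteq> L"
    and elem: "\<And>i j. i < n \<Longrightarrow> j < n \<Longrightarrow> i \<noteq> j \<Longrightarrow> \<exists>m\<in>L. mat_cong n 2 m (elem_mat n i j)"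
begin

lemma mem_SL: "g \<in> L \<Longrightarrow> g \<in> carrier (SL n)"
  by (rule subgroup.mem_carrier[OF L])

lemma mult_mem: "g \<in> L \<Longrightarrow> h \<in> L \<Longrightarrow> g * h \<in> L"
  using subgroup.m_closed[OF L] by simp

text \<open>
  The elements \<open>e\<close> and \<open>m\<close> differ by a factor congruent to 1 modulo 2, which commutes with \<open>k\<close>
  modulo 4. Hence conjugation by \<open>e\<close>, which may lie outside \<open>L\<close>, has the same effect on \<open>k\<close>
  modulo 4 as conjugation by \<open>m\<close>.
\<close>

lemma conj_mem:
  assumes e: "e \<in> carrier (SL n)" and m: "m \<in> L" and me: "mat_cong n 2 m e"
    and k: "k \<in> L" "mat_cong n 2 k (1\<^sub>m n)"
  shows "e * k * inv\<^bsub>SL n\<^esub> e \<in> L"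
proof -
  let ?i = "inv\<^bsub>SL n\<^esub> e"
  note mc = mem_SL[OF m] and kc = mem_SL[OF k(1)] and ic = SL.inv_closed[OF e]
  define c where "c = ?i * m"
  have cc: "c \<in> carrier (SL n)" unfolding c_def using ic mc by (rule SL_mult_closed)
  have ec: "e * c = m"
    unfolding c_def by (simp only: SL_assoc[OF e ic mc, symmetric] SL_r_inv[OF e] SL_l_one[OF mc])
  have "mat_cong n 2 (e * c) e" using me ec by simp
  then have c1: "mat_cong n 2 c (1\<^sub>m n)" by (rule mat_cong_mult_cancel[OF e cc])
  have ek: "e * k \<in> carrier (SL n)" using e kc by (rule SL_mult_closed)
  have eki: "e * k * ?i \<in> carrier (SL n)" using ek ic by (rule SL_mult_closed)
  have "mat_cong n 4 (e * (k * c)) (e * (c * k))"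
    by (rule mat_cong_mult[OF mat_cong_refl near_one_commute[OF kc k(2) cc c1] e e
          SL_mult_closed[OF kc cc] SL_mult_closed[OF cc kc]])
  also have "e * (c * k) = m * k"
    by (simp only: SL_assoc[OF e cc kc, symmetric] ec)
  also have "e * (k * c) = e * k * ?i * m"
    unfolding SL_assoc[OF ek ic mc] c_def[symmetric] by (rule SL_assoc[OF e kc cc, symmetric])
  finally have "mat_cong n 4 (e * k * ?i * m) (m * k)" .
  then have "e * k * ?i * m \<in> L"
    using congruent_to_member[OF L Gam mult_mem[OF m k(1)] SL_mult_closed[OF eki mc]] by blast
  then have "e * k * ?i * m * inv\<^bsub>SL n\<^esub> m \<in> L"
    using mult_mem subgroup.m_inv_closed[OF L m] by blast
  then show ?thesis
    by (simp only: SL_assoc[OF eki mc SL.inv_closed[OF mc]] SL_r_inv[OF mc] SL_r_one[OF eki])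
qed

lemma realizes_cong:
  assumes "realizes n L f" "\<And>r c. r < n \<Longrightarrow> c < n \<Longrightarrow> even (f r c) \<longleftrightarrow> even (g r c)"
  shows "realizes n L g"
proof -
  have *: "[x = d + 2 * g r c] (mod 4)" if "r < n" "c < n" "[x = d + 2 * f r c] (mod 4)" for r c x d
  proof -
    have "2 dvd f r c - g r c" using assms(2)[OF that(1,2)] by simp
    then obtain q where "f r c = g r c + 2 * q" by (metis add.commute diff_add_cancel dvdE)
    then show ?thesis using that(3) by (simp add: cong_iff_dvd_diff) presburger
  qed
  show ?thesis using assms(1) * unfolding realizes_def by meson
qed

lemma realizes_zero: "realizes n L (\<lambda>r c. 0)"
  unfolding realizes_def using subgroup.one_closed[OF L] by (intro bexI[of _ "1\<^sub>m n"]) auto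

lemma realizes_add:
  assumes "realizes n L f" "realizes n L g"
  shows "realizes n L (\<lambda>r c. f r c + g r c)"
proof -
  obtain k where k: "k \<in> L" "\<And>r c. r < n \<Longrightarrow> c < n \<Longrightarrow>
      [k $$ (r, c) = (if r = c then 1 else 0) + 2 * f r c] (mod 4)"
    using assms(1) by (auto simp: realizes_def)
  obtain l where l: "l \<in> L" "\<And>r c. r < n \<Longrightarrow> c < n \<Longrightarrow>
      [l $$ (r, c) = (if r = c then 1 else 0) + 2 * g r c] (mod 4)"
    using assms(2) by (auto simp: realizes_def)
  show ?thesis
    unfolding realizes_def
    using mult_near_one[OF mem_SL[OF k(1)] k(2) mem_SL[OF l(1)] l(2)] mult_mem[OF k(1) l(1)]
    by (intro bexI[of _ "k * l"]) auto
qed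

lemma realizes_scale:
  assumes "realizes n L f"
  shows "realizes n L (\<lambda>r c. a * f r c)"
proof (cases "even a")
  case True
  then show ?thesis by (intro realizes_cong[OF realizes_zero]) auto
next
  case False
  then show ?thesis by (intro realizes_cong[OF assms]) auto
qed

text \<open>
  Let \<open>E\<^sub>i\<^sub>j\<close> be the matrix unit. For \<open>E = 1 + E\<^sub>i\<^sub>j\<close> the matrix below is \<open>E A E\<^sup>-\<^sup>1 - A = [E\<^sub>i\<^sub>j, A] - A\<^sub>j\<^sub>i E\<^sub>i\<^sub>j\<close>, with \<open>A = f\<close>.
\<close>

lemma realizes_bracket:
  assumes f: "realizes n L f" and ij: "i < n" "j < n" "i \<noteq> j"
  shows "realizes n L (\<lambda>r c. (if r = i then f j c else 0)
    - (if c = j then f r i + (if r = i then f j i else 0) else 0))"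
proof -
  obtain k where k: "k \<in> L" "\<And>r c. r < n \<Longrightarrow> c < n \<Longrightarrow>
      [k $$ (r, c) = (if r = c then 1 else 0) + 2 * f r c] (mod 4)"
    using f by (auto simp: realizes_def)
  have k1: "mat_cong n 2 k (1\<^sub>m n)"
    unfolding mat_cong_def
  proof (intro allI impI)
    fix r c assume rc: "r < n" "c < n"
    have "[k $$ (r, c) = (if r = c then 1 else 0) + 2 * f r c] (mod 2)"
      by (rule cong_dvd_modulus[OF k(2)[OF rc]]) simp
    then show "[k $$ (r, c) = 1\<^sub>m n $$ (r, c)] (mod 2)"
      using rc by (simp add: cong_2_iff)
  qed
  obtain m where m: "m \<in> L" "mat_cong n 2 m (elem_mat n i j)" using elem[OF ij] by blast
  let ?k = "elem_mat n i j * k * inv\<^bsub>SL n\<^esub> (elem_mat n i j)"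
  have "?k \<in> L" by (rule conj_mem[OF elem_SL[OF ij(3)] m k(1) k1])
  moreover have "[?k $$ (r, c) = (if r = c then 1 else 0) + 2 * (f r c + (if r = i then f j c else 0)
      - (if c = j then f r i + (if r = i then f j i else 0) else 0))] (mod 4)"
    if rc: "r < n" "c < n" for r c
  proof -
    define T where "T r c = (if r = c then 1 else 0) + 2 * f r c" for r c
    have "[?k $$ (r, c) = T r c + (if r = i then T j c else 0)
        - (if c = j then T r i + (if r = i then T j i else 0) else 0)] (mod 4)"
      unfolding elem_conj_entry[OF mem_SL[OF k(1)] ij rc]
      using ij rc by (intro cong_diff cong_add) (auto intro!: cong_add simp: k(2)[folded T_def])
    moreover have "T r c + (if r = i then T j c else 0)
        - (if c = j then T r i + (if r = i then T j i else 0) else 0) =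
        (if r = c then 1 else 0) + 2 * (f r c + (if r = i then f j c else 0)
        - (if c = j then f r i + (if r = i then f j i else 0) else 0))"
      using ij(3) by (simp add: T_def algebra_simps)
    ultimately show ?thesis by simp
  qed
  ultimately have "realizes n L (\<lambda>r c. f r c + (if r = i then f j c else 0)
      - (if c = j then f r i + (if r = i then f j i else 0) else 0))"
    unfolding realizes_def by blast
  from realizes_add[OF f this] show ?thesis by (rule realizes_cong) auto
qed

lemma realizes_unit_column:
  assumes "realizes n L (matrix_unit i k)" "i < n" "k < n" "b < n" "b \<noteq> i" "b \<noteq> k" "i \<noteq> k"
  shows "realizes n L (matrix_unit i b)"
proof -
  have "k \<noteq> b" using assms(6) by simp
  from realizes_bracket[OF assms(1,3,4) this] show ?thesis
    by (rule realizes_cong) (use assms in \<open>auto simp: matrix_unit_def\<close>)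
qed

lemma realizes_unit_row:
  assumes "realizes n L (matrix_unit i k)" "i < n" "k < n" "a < n" "a \<noteq> i" "a \<noteq> k" "i \<noteq> k"
  shows "realizes n L (matrix_unit a k)"
  using realizes_bracket[OF assms(1,4,2,5)]
  by (rule realizes_cong) (use assms in \<open>auto simp: matrix_unit_def\<close>)

lemma third_index:
  assumes "3 \<le> n"
  obtains k where "k < n" "k \<noteq> i" "k \<noteq> (j::nat)"
proof -
  have "\<exists>k\<in>{0, 1, 2}. k \<noteq> i \<and> k \<noteq> j" by auto
  then obtain k where "k \<in> {0, 1, 2}" "k \<noteq> i" "k \<noteq> j" by blast
  then show ?thesis using assms by (intro that[of k]) auto
qed

lemma realizes_all_units:
  assumes n: "3 \<le> n" and u: "realizes n L (matrix_unit i k)" "i < n" "k < n" "i \<noteq> k"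
    and ab: "a < n" "b < n" "a \<noteq> b"
  shows "realizes n L (matrix_unit a b)"
proof -
  have *: "realizes n L (matrix_unit a b)"
    if "realizes n L (matrix_unit i k)" "i < n" "k < n" "i \<noteq> k" "a \<noteq> k" for i k
  proof -
    have "realizes n L (matrix_unit a k)"
      using realizes_unit_row[OF that(1-3) ab(1)] that by (cases "a = i") auto
    then show ?thesis
      using realizes_unit_column[OF _ ab(1) that(3) ab(2)] that ab by (cases "b = k") auto
  qed
  obtain c where c: "c < n" "c \<noteq> i" "c \<noteq> k" using third_index[OF n] .
  show ?thesis
  proof (cases "a = k")
    case True
    then show ?thesis
      using *[OF realizes_unit_column[OF u(1-3) c(1-3) u(4)] u(2) c(1)] c by auto
  qed (use *[OF u] in simp)
qed

text \<open>
  This is the irreducibility argument: modulo 2 the realized matrices form a submodule of the adjoint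
  module, and brackets with elementary matrices cut a nonscalar member down to a matrix unit.
\<close>

lemma nonscalar_realizes_units:
  assumes n: "3 \<le> n" and f: "realizes n L f"
    and nonscalar: "(\<exists>i<n. \<exists>j<n. i \<noteq> j \<and> odd (f i j)) \<or> (\<exists>i<n. \<exists>j<n. odd (f i i - f j j))"
    and ab: "a < n" "b < n" "a \<noteq> b"
  shows "realizes n L (matrix_unit a b)"
proof (cases "\<exists>i<n. \<exists>j<n. i \<noteq> j \<and> odd (f j i)")
  case True
  then obtain i j where ij: "i < n" "j < n" "i \<noteq> j" "odd (f j i)" by blast
  obtain k where k: "k < n" "k \<noteq> i" "k \<noteq> j" using third_index[OF n] .
  have ik: "i \<noteq> k" and jk: "j \<noteq> k" using k by auto
  \<comment> \<open>Two brackets with the row index \<open>i\<close> leave only the row \<open>i\<close>, supported in the columns \<open>j, k\<close>.\<close>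
  have row: "realizes n L (\<lambda>r c. f k i * matrix_unit i j r c + matrix_unit i k r c)"
    using realizes_bracket[OF realizes_bracket[OF f ij(1-3)] ij(1) k(1) ik]
    by (rule realizes_cong) (use ij k in \<open>auto simp: matrix_unit_def\<close>)
  have "realizes n L (matrix_unit i k)"
  proof (cases "even (f k i)")
    case True
    show ?thesis by (rule realizes_cong[OF row]) (use True in simp)
  next
    case False
    show ?thesis
      using realizes_bracket[OF row ij(2) k(1) jk]
      by (rule realizes_cong) (use False ij k in \<open>auto simp: matrix_unit_def\<close>)
  qed
  then show ?thesis using realizes_all_units[OF n _ ij(1) k(1) ik ab] by blast
next
  case False
  then obtain i j where ij: "i < n" "j < n" "odd (f i i - f j j)" using nonscalar by blast
  then have ne: "i \<noteq> j" by auto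
  have "realizes n L (matrix_unit i j)"
    using realizes_bracket[OF f ij(1,2) ne]
    by (rule realizes_cong) (use False ij ne in \<open>auto simp: matrix_unit_def\<close>)
  then show ?thesis using realizes_all_units[OF n _ ij(1,2) ne ab] by blast
qed

end

section \<open>Three by three matrices\<close>

lemma det_2:
  fixes A :: "int mat"
  assumes A: "A \<in> carrier_mat 2 2"
  shows "det A = A $$ (0, 0) * A $$ (1, 1) - A $$ (0, 1) * A $$ (1, 0)"
  using A
  by (subst laplace_expansion_row[OF A, of 0])
    (simp_all add: numeral_2_eq_2 cofactor_def det_single mat_delete_def)

lemma det_3:
  fixes A :: "int mat"
  assumes A: "A \<in> carrier_mat 3 3"
  shows "det A = A $$ (0, 0) * (A $$ (1, 1) * A $$ (2, 2) - A $$ (1, 2) * A $$ (2, 1))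
    - A $$ (0, 1) * (A $$ (1, 0) * A $$ (2, 2) - A $$ (1, 2) * A $$ (2, 0))
    + A $$ (0, 2) * (A $$ (1, 0) * A $$ (2, 1) - A $$ (1, 1) * A $$ (2, 0))"
proof -
  have d: "mat_delete A 0 j \<in> carrier_mat 2 2" for j
    using A by (simp add: mat_delete_def)
  have "det A = (\<Sum>j<3. A $$ (0, j) * cofactor A 0 j)"
    by (rule laplace_expansion_row[OF A]) simp
  moreover have "det (mat_delete A 0 0) = A $$ (1, 1) * A $$ (2, 2) - A $$ (1, 2) * A $$ (2, 1)"
    "det (mat_delete A 0 1) = A $$ (1, 0) * A $$ (2, 2) - A $$ (1, 2) * A $$ (2, 0)"
    "det (mat_delete A 0 2) = A $$ (1, 0) * A $$ (2, 1) - A $$ (1, 1) * A $$ (2, 0)"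
    using A by (simp_all add: det_2[OF d]) (simp_all add: mat_delete_def numeral_2_eq_2)
  ultimately show ?thesis
    by (simp add: numeral_3_eq_3 numeral_2_eq_2 cofactor_def)
qed

section \<open>A complement to the kernel of reduction from modulo 4 to modulo 2\<close>

text \<open>
  One lift modulo 4, up to sign, of each nonzero vector modulo 2. In suitable coordinates these are
  plus and minus the seventh roots of unity in the Galois ring of order 64 and characteristic 4. The
  coordinates here make the set invariant under cyclic permutations.
\<close>

definition lifts :: "(int \<times> int \<times> int) set" where
  "lifts = {(1, 0, 0), (3, 0, 0), (0, 1, 0), (0, 3, 0), (0, 0, 1), (0, 0, 3), (1, 1, 1), (3, 3, 3),
     (1, 3, 2), (3, 1, 2), (2, 1, 3), (2, 3, 1), (3, 2, 1), (1, 2, 3)}"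

definition lifted_point :: "int \<Rightarrow> int \<Rightarrow> int \<Rightarrow> bool" where
  "lifted_point x y z \<longleftrightarrow> (x mod 4, y mod 4, z mod 4) \<in> lifts"

definition lift_stabilizer :: "int mat set" where
  "lift_stabilizer = {g \<in> carrier (SL 3). \<forall>x y z. lifted_point x y z \<longrightarrow>
    lifted_point (g $$ (0, 0) * x + g $$ (0, 1) * y + g $$ (0, 2) * z)
      (g $$ (1, 0) * x + g $$ (1, 1) * y + g $$ (1, 2) * z)
      (g $$ (2, 0) * x + g $$ (2, 1) * y + g $$ (2, 2) * z)}"

lemma less_3_cases: "(i::nat) < 3 \<longleftrightarrow> i = 0 \<or> i = 1 \<or> i = 2"
  by auto

lemma mult_entry_3:
  assumes "A \<in> carrier_mat 3 3" "B \<in> carrier_mat 3 3" "i < 3" "j < 3"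
  shows "(A * B) $$ (i, j) = A $$ (i, 0) * B $$ (0, j) + A $$ (i, 1) * B $$ (1, j) + A $$ (i, 2) * B $$ (2, j)"
  using mult_entry[OF assms] by (simp add: numeral_3_eq_3 numeral_2_eq_2)

lemma lifted_point_cong:
  "\<lbrakk>[x = x'] (mod 4); [y = y'] (mod 4); [z = z'] (mod 4)\<rbrakk> \<Longrightarrow> lifted_point x y z \<longleftrightarrow> lifted_point x' y' z'"
  by (simp add: lifted_point_def cong_def)

lemma congruence_subgroup_lift_stabilizer: "congruence_subgroup 3 4 \<subseteq> lift_stabilizer"
proof
  fix g assume g: "g \<in> congruence_subgroup 3 4"
  have e: "[g $$ (r, c) = (if r = c then 1 else 0)] (mod 4)" if "r < 3" "c < 3" for r c
    using g that by (auto simp: congruence_subgroup_def mat_cong_def)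
  have row: "[g $$ (r, 0) * x + g $$ (r, 1) * y + g $$ (r, 2) * z =
      (if r = 0 then 1 else 0) * x + (if r = 1 then 1 else 0) * y + (if r = 2 then 1 else 0) * z] (mod 4)"
    if "r < 3" for r x y z
    using e[OF that, of 0] e[OF that, of 1] e[OF that, of 2]
    by (intro cong_add cong_mult) auto
  have "lifted_point (g $$ (0, 0) * x + g $$ (0, 1) * y + g $$ (0, 2) * z)
      (g $$ (1, 0) * x + g $$ (1, 1) * y + g $$ (1, 2) * z)
      (g $$ (2, 0) * x + g $$ (2, 1) * y + g $$ (2, 2) * z) \<longleftrightarrow> lifted_point x y z" for x y z
    using row[of 0 x y z] row[of 1 x y z] row[of 2 x y z] by (intro lifted_point_cong) auto
  then show "g \<in> lift_stabilizer"
    using g by (simp add: lift_stabilizer_def congruence_subgroup_def)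
qed

lemma lift_stabilizer_mult:
  assumes g: "g \<in> lift_stabilizer" and h: "h \<in> lift_stabilizer"
  shows "g * h \<in> lift_stabilizer"
proof -
  have c: "g \<in> carrier (SL 3)" "h \<in> carrier (SL 3)" using g h by (auto simp: lift_stabilizer_def)
  note entry = mult_entry_3[OF c[THEN SL_carrier_mat]]
  have row: "(g * h) $$ (r, 0) * x + (g * h) $$ (r, 1) * y + (g * h) $$ (r, 2) * z =
      g $$ (r, 0) * (h $$ (0, 0) * x + h $$ (0, 1) * y + h $$ (0, 2) * z) +
      g $$ (r, 1) * (h $$ (1, 0) * x + h $$ (1, 1) * y + h $$ (1, 2) * z) +
      g $$ (r, 2) * (h $$ (2, 0) * x + h $$ (2, 1) * y + h $$ (2, 2) * z)" if "r < 3" for r x y z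
    unfolding entry[OF that, of 0, simplified] entry[OF that, of 1, simplified]
      entry[OF that, of 2, simplified] by (simp add: algebra_simps entry[OF that] del: index_mult_mat)
  show ?thesis
    using g h SL_mult_closed[OF c] row[of 0] row[of 1] row[of 2]
    by (simp add: lift_stabilizer_def del: index_mult_mat)
qed

lemma lift_stabilizer_subgroup: "subgroup lift_stabilizer (SL 3)"
  using congruence_subgroup_lift_stabilizer lift_stabilizer_mult
  by (intro subgroup_containing_congruence_subgroup[where k = 4]) (auto simp: lift_stabilizer_def)

text \<open>
  The three elementary matrices are cyclic permutations of one another, and so are the members of the
  stabilizer congruent to them. The first of these members has the rows \<open>(1, 1, 0)\<close>, \<open>(0, -1, 0)\<close>,
  \<open>(0, 2, -1)\<close>.
\<close>

lemma lift_stabilizer_elem: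
  assumes "(i, j) \<in> {(0, 1), (1, 2), (2, 0)}"
  shows "\<exists>m\<in>lift_stabilizer. mat_cong 3 2 m (elem_mat 3 i j)"
proof -
  define t where "t a b d = mat 3 3 (\<lambda>(r, s).
      if r = a \<and> (s = a \<or> s = b) then 1
      else if r = b \<and> s = b \<or> r = d \<and> s = d then - 1
      else if r = d \<and> s = b then 2 else (0::int))" for a b d :: nat
  have entry: "t a b d $$ (r, s) = (if r = a \<and> (s = a \<or> s = b) then 1
      else if r = b \<and> s = b \<or> r = d \<and> s = d then - 1
      else if r = d \<and> s = b then 2 else 0)" if "r < 3" "s < 3" for a b d r s
    using that by (simp add: t_def)
  have tc: "t a b d \<in> carrier_mat 3 3" for a b d by (simp add: t_def)
  have SL: "t 0 1 2 \<in> carrier (SL 3)" "t 1 2 0 \<in> carrier (SL 3)" "t 2 0 1 \<in> carrier (SL 3)"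
    by (intro SL_I tc; simp add: det_3[OF tc] entry)+
  have "\<forall>(x, y, z)\<in>lifts. lifted_point (x + y) (- y) (2 * y - z) \<and>
      lifted_point (2 * z - x) (y + z) (- z) \<and> lifted_point (- x) (2 * x - y) (z + x)"
    by (simp add: lifts_def lifted_point_def)
  then have shear_lifts: "lifted_point (x + y) (- y) (2 * y - z)"
      "lifted_point (2 * z - x) (y + z) (- z)" "lifted_point (- x) (2 * x - y) (z + x)"
    if "(x, y, z) \<in> lifts" for x y z
    using that by blast+
  have shear: "lifted_point (x + y) (- y) (2 * y - z)" "lifted_point (2 * z - x) (y + z) (- z)"
      "lifted_point (- x) (2 * x - y) (z + x)" if "lifted_point x y z" for x y z
  proof -
    have red: "[a = a mod 4] (mod 4)" for a :: int by (simp add: cong_def)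
    note l = that[unfolded lifted_point_def]
    show "lifted_point (x + y) (- y) (2 * y - z)"
      by (rule lifted_point_cong[THEN iffD2, OF _ _ _ shear_lifts(1)[OF l]])
        (intro cong_add cong_diff cong_mult cong_refl red cong_minus_minus_iff[THEN iffD2])+
    show "lifted_point (2 * z - x) (y + z) (- z)"
      by (rule lifted_point_cong[THEN iffD2, OF _ _ _ shear_lifts(2)[OF l]])
        (intro cong_add cong_diff cong_mult cong_refl red cong_minus_minus_iff[THEN iffD2])+
    show "lifted_point (- x) (2 * x - y) (z + x)"
      by (rule lifted_point_cong[THEN iffD2, OF _ _ _ shear_lifts(3)[OF l]])
        (intro cong_add cong_diff cong_mult cong_refl red cong_minus_minus_iff[THEN iffD2])+
  qed
  have "t 0 1 2 \<in> lift_stabilizer" "t 1 2 0 \<in> lift_stabilizer" "t 2 0 1 \<in> lift_stabilizer"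
    using SL shear by (auto simp: lift_stabilizer_def entry algebra_simps)
  moreover have "mat_cong 3 2 (t 0 1 2) (elem_mat 3 0 1)" "mat_cong 3 2 (t 1 2 0) (elem_mat 3 1 2)"
    "mat_cong 3 2 (t 2 0 1) (elem_mat 3 2 0)"
    by (auto simp: mat_cong_def cong_2_iff entry less_3_cases)
  ultimately show ?thesis using assms by auto
qed

lemma lift_stabilizer_surjective_mod_2:
  assumes g: "g \<in> carrier (SL 3)"
  shows "\<exists>m\<in>lift_stabilizer. mat_cong 3 2 m g"
proof -
  let ?R = "{g \<in> carrier (SL 3). \<exists>m\<in>lift_stabilizer. mat_cong 3 2 m g}"
  have mc: "m \<in> carrier (SL 3)" if "m \<in> lift_stabilizer" for m
    using that by (simp add: lift_stabilizer_def)
  have one: "1\<^sub>m 3 \<in> lift_stabilizer"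
    using subgroup.one_closed[OF lift_stabilizer_subgroup] by simp
  have Gam: "congruence_subgroup 3 2 \<subseteq> ?R"
    using one by (auto simp: congruence_subgroup_def intro: mat_cong_sym)
  have R: "subgroup ?R (SL 3)"
  proof (rule subgroup_containing_congruence_subgroup[OF _ _ Gam])
    fix g h assume g: "g \<in> ?R" and h: "h \<in> ?R"
    then obtain m m' where m: "m \<in> lift_stabilizer" "mat_cong 3 2 m g"
      and m': "m' \<in> lift_stabilizer" "mat_cong 3 2 m' h" by blast
    have "mat_cong 3 2 (m * m') (g * h)"
      by (rule mat_cong_mult[OF m(2) m'(2) mc[OF m(1)] _ mc[OF m'(1)]]) (use g h in auto)
    moreover have "g * h \<in> carrier (SL 3)"
      by (rule SL_mult_closed) (use g h in auto)
    ultimately show "g * h \<in> ?R" using lift_stabilizer_mult[OF m(1) m'(1)] by blast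
  qed auto
  have base: "elem_mat 3 i j \<in> ?R" if "(i, j) \<in> {(0, 1), (1, 2), (2, 0)}" for i j
    using that lift_stabilizer_elem[OF that] elem_SL[of i j 3] by auto
  have "elem_mat 3 0 2 \<in> ?R"
    by (rule elem_commutator_closed[OF R, of 0 1 2]) (simp_all add: base del: mem_Collect_eq)
  moreover have "elem_mat 3 1 0 \<in> ?R"
    by (rule elem_commutator_closed[OF R, of 1 2 0]) (simp_all add: base del: mem_Collect_eq)
  moreover have "elem_mat 3 2 1 \<in> ?R"
    by (rule elem_commutator_closed[OF R, of 2 0 1]) (simp_all add: base del: mem_Collect_eq)
  ultimately have "elem_mat 3 i j \<in> ?R" if "i < 3" "j < 3" "i \<noteq> j" for i j
    using that base[of i j] unfolding less_3_cases by (elim disjE) (simp_all del: mem_Collect_eq)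
  then have "?R = carrier (SL 3)" by (rule SL_generated_by_elem_mod_2[OF R Gam])
  then show ?thesis using g by blast
qed

lemma SL_3_not_minus_one_mod_4:
  fixes g :: "int mat"
  assumes g: "g \<in> carrier (SL 3)"
    and minus: "\<And>r c. r < 3 \<Longrightarrow> c < 3 \<Longrightarrow> [g $$ (r, c) = (if r = c then - 1 else 0)] (mod 4)"
  shows False
proof -
  have "[det g = - 1 * (- 1 * - 1 - 0 * 0) - 0 * (0 * - 1 - 0 * 0) + 0 * (0 * 0 - - 1 * 0)] (mod 4)"
    unfolding det_3[OF SL_carrier_mat[OF g]]
    using minus[of 0 0] minus[of 0 1] minus[of 0 2] minus[of 1 0] minus[of 1 1] minus[of 1 2]
      minus[of 2 0] minus[of 2 1] minus[of 2 2]
    by (intro cong_add cong_diff cong_mult) simp_all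
  then show False using SL_det[OF g] by (simp add: cong_def)
qed

lemma lifted_point_parity:
  assumes "lifted_point x y z"
  shows "odd x \<Longrightarrow> even y \<Longrightarrow> even z \<Longrightarrow> [y = 0] (mod 4) \<and> [z = 0] (mod 4)"
    and "even x \<Longrightarrow> odd y \<Longrightarrow> even z \<Longrightarrow> [x = 0] (mod 4) \<and> [z = 0] (mod 4)"
    and "even x \<Longrightarrow> even y \<Longrightarrow> odd z \<Longrightarrow> [x = 0] (mod 4) \<and> [y = 0] (mod 4)"
    and "odd x \<Longrightarrow> odd y \<Longrightarrow> odd z \<Longrightarrow> (x mod 4, y mod 4, z mod 4) \<in> {(1, 1, 1), (3, 3, 3)}"
proof -
  have "\<forall>(a, b, c)\<in>lifts. (odd a \<longrightarrow> even b \<longrightarrow> even c \<longrightarrow> b = 0 \<and> c = 0) \<and>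
      (even a \<longrightarrow> odd b \<longrightarrow> even c \<longrightarrow> a = 0 \<and> c = 0) \<and>
      (even a \<longrightarrow> even b \<longrightarrow> odd c \<longrightarrow> a = 0 \<and> b = 0) \<and>
      (odd a \<longrightarrow> odd b \<longrightarrow> odd c \<longrightarrow> (a, b, c) \<in> {(1, 1, 1), (3, 3, 3)})"
    by (simp add: lifts_def)
  from bspec[OF this assms[unfolded lifted_point_def]]
  show "odd x \<Longrightarrow> even y \<Longrightarrow> even z \<Longrightarrow> [y = 0] (mod 4) \<and> [z = 0] (mod 4)"
    "even x \<Longrightarrow> odd y \<Longrightarrow> even z \<Longrightarrow> [x = 0] (mod 4) \<and> [z = 0] (mod 4)"
    "even x \<Longrightarrow> even y \<Longrightarrow> odd z \<Longrightarrow> [x = 0] (mod 4) \<and> [y = 0] (mod 4)"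
    "odd x \<Longrightarrow> odd y \<Longrightarrow> odd z \<Longrightarrow> (x mod 4, y mod 4, z mod 4) \<in> {(1, 1, 1), (3, 3, 3)}"
    by (simp_all add: dvd_mod_iff cong_def)
qed

text \<open>
  Such a \<open>g\<close> maps each of \<open>e\<^sub>0, e\<^sub>1, e\<^sub>2, e\<^sub>0 + e\<^sub>1 + e\<^sub>2\<close> to itself up to sign modulo 4. The last vector
  forces the signs to agree, and the determinant excludes \<open>-1\<close>.
\<close>

lemma lift_stabilizer_near_one:
  assumes g: "g \<in> lift_stabilizer" and g1: "mat_cong 3 2 g (1\<^sub>m 3)"
  shows "mat_cong 3 4 g (1\<^sub>m 3)"
proof -
  have gc: "g \<in> carrier (SL 3)" using g by (simp add: lift_stabilizer_def)
  have par: "odd (g $$ (r, c)) \<longleftrightarrow> r = c" if "r < 3" "c < 3" for r c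
    using g1 that by (auto simp: mat_cong_def cong_2_iff)
  have pt: "lifted_point x y z \<Longrightarrow> lifted_point (g $$ (0, 0) * x + g $$ (0, 1) * y + g $$ (0, 2) * z)
      (g $$ (1, 0) * x + g $$ (1, 1) * y + g $$ (1, 2) * z)
      (g $$ (2, 0) * x + g $$ (2, 1) * y + g $$ (2, 2) * z)" for x y z
    using g by (simp add: lift_stabilizer_def)
  have col: "lifted_point (g $$ (0, 0)) (g $$ (1, 0)) (g $$ (2, 0))"
    "lifted_point (g $$ (0, 1)) (g $$ (1, 1)) (g $$ (2, 1))"
    "lifted_point (g $$ (0, 2)) (g $$ (1, 2)) (g $$ (2, 2))"
    using pt[of 1 0 0] pt[of 0 1 0] pt[of 0 0 1] by (simp_all add: lifted_point_def lifts_def)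
  have off: "[g $$ (r, c) = 0] (mod 4)" if "r < 3" "c < 3" "r \<noteq> c" for r c
    using lifted_point_parity(1)[OF col(1)] lifted_point_parity(2)[OF col(2)]
      lifted_point_parity(3)[OF col(3)] that par[of 0 0] par[of 0 1] par[of 0 2] par[of 1 0]
      par[of 1 1] par[of 1 2] par[of 2 0] par[of 2 1] par[of 2 2]
    unfolding less_3_cases by auto
  have "lifted_point (g $$ (0, 0) + g $$ (0, 1) + g $$ (0, 2)) (g $$ (1, 0) + g $$ (1, 1) + g $$ (1, 2))
      (g $$ (2, 0) + g $$ (2, 1) + g $$ (2, 2))"
    using pt[of 1 1 1] by (simp add: lifted_point_def lifts_def)
  moreover have "[g $$ (0, 0) + g $$ (0, 1) + g $$ (0, 2) = g $$ (0, 0) + 0 + 0] (mod 4)"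
    "[g $$ (1, 0) + g $$ (1, 1) + g $$ (1, 2) = 0 + g $$ (1, 1) + 0] (mod 4)"
    "[g $$ (2, 0) + g $$ (2, 1) + g $$ (2, 2) = 0 + 0 + g $$ (2, 2)] (mod 4)"
    by (intro cong_add cong_refl off; simp)+
  note lifted_point_cong[OF this]
  ultimately have "lifted_point (g $$ (0, 0)) (g $$ (1, 1)) (g $$ (2, 2))"
    by simp
  then consider "g $$ (0, 0) mod 4 = 1" "g $$ (1, 1) mod 4 = 1" "g $$ (2, 2) mod 4 = 1"
    | "g $$ (0, 0) mod 4 = 3" "g $$ (1, 1) mod 4 = 3" "g $$ (2, 2) mod 4 = 3"
    using lifted_point_parity(4)[of "g $$ (0, 0)" "g $$ (1, 1)" "g $$ (2, 2)"]
      par[of 0 0] par[of 1 1] par[of 2 2] by auto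
  then show ?thesis
  proof cases
    case 1
    then have "[g $$ (r, r) = 1] (mod 4)" if "r < 3" for r
      using that unfolding less_3_cases cong_def by auto
    then show ?thesis unfolding mat_cong_def using off by simp
  next
    case 2
    then have "[g $$ (r, r) = - 1] (mod 4)" if "r < 3" for r
      using that unfolding less_3_cases cong_def by auto
    then have False using off by (intro SL_3_not_minus_one_mod_4[OF gc]) auto
    then show ?thesis ..
  qed
qed

text \<open>
  A larger subgroup contains an element congruent to 1 modulo 2 outside \<open>M\<close>; by irreducibility it then
  contains everything congruent to 1 modulo 2.
\<close>

lemma lift_stabilizer_maximal:
  assumes L: "subgroup L (SL 3)" and base: "lift_stabilizer \<subseteq> L"
    and g: "g \<in> L" "g \<notin> lift_stabilizer"
  shows "L = carrier (SL 3)"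
proof -
  have Gam4: "congruence_subgroup 3 4 \<subseteq> L"
    using congruence_subgroup_lift_stabilizer base by blast
  interpret elementary_mod_2 3 L
  proof (rule elementary_mod_2.intro)
    fix i j :: nat assume "i < 3" "j < 3" "i \<noteq> j"
    then show "\<exists>m\<in>L. mat_cong 3 2 m (elem_mat 3 i j)"
      using lift_stabilizer_surjective_mod_2[OF elem_SL] base by blast
  qed (fact L Gam4)+
  have gc: "g \<in> carrier (SL 3)" using mem_SL[OF g(1)] .
  obtain m where m: "m \<in> lift_stabilizer" "mat_cong 3 2 m g"
    using lift_stabilizer_surjective_mod_2[OF gc] by blast
  have mL: "m \<in> L" and mc: "m \<in> carrier (SL 3)" using m base mem_SL by auto
  define k where "k = inv\<^bsub>SL 3\<^esub> m * g"
  have kL: "k \<in> L"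
    unfolding k_def using mult_mem[OF subgroup.m_inv_closed[OF L mL] g(1)] .
  have kc: "k \<in> carrier (SL 3)" using mem_SL[OF kL] .
  have mk: "m * k = g"
    unfolding k_def
    by (simp only: SL_assoc[OF mc SL.inv_closed[OF mc] gc, symmetric] SL_r_inv[OF mc] SL_l_one[OF gc])
  then have k2: "mat_cong 3 2 k (1\<^sub>m 3)"
    using mat_cong_mult_cancel[OF mc kc] mat_cong_sym[OF m(2)] by simp
  have k4: "\<not> mat_cong 3 4 k (1\<^sub>m 3)"
  proof
    assume "mat_cong 3 4 k (1\<^sub>m 3)"
    then have "k \<in> lift_stabilizer"
      using congruence_subgroup_lift_stabilizer kc by (auto simp: congruence_subgroup_def)
    then show False using lift_stabilizer_mult[OF m(1)] mk g(2) by auto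
  qed
  obtain f where f: "\<And>r c. r < 3 \<Longrightarrow> c < 3 \<Longrightarrow> k $$ (r, c) = (if r = c then 1 else 0) + 2 * f r c"
    using near_one_expand[OF k2] by blast
  have rf: "realizes 3 L f" unfolding realizes_def using f by (intro bexI[OF _ kL]) simp
  have nonscalar: "(\<exists>i<3. \<exists>j<3. i \<noteq> j \<and> odd (f i j)) \<or> (\<exists>i<3. \<exists>j<3. odd (f i i - f j j))"
  proof (rule ccontr)
    assume scalar: "\<not> ?thesis"
    have off: "even (f i j)" if "i < 3" "j < 3" "i \<noteq> j" for i j
      using scalar that by blast
    have diag: "even (f i i) \<longleftrightarrow> even (f 0 0)" if "i < 3" for i
    proof -
      have "(0::nat) < 3" by simp
      then have "even (f i i - f 0 0)" using scalar that by blast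
      then show ?thesis by simp
    qed
    show False
    proof (cases "even (f 0 0)")
      case True
      have "mat_cong 3 4 k (1\<^sub>m 3)"
        unfolding mat_cong_def
      proof (intro allI impI)
        fix r c :: nat assume rc: "r < 3" "c < 3"
        have "even (f r c)" using off[OF rc] diag[OF rc(1)] True by (cases "r = c") auto
        then show "[k $$ (r, c) = 1\<^sub>m 3 $$ (r, c)] (mod 4)"
          using f[OF rc] rc by (auto simp: cong_iff_dvd_diff)
      qed
      then show False using k4 by blast
    next
      case False
      have "[k $$ (r, c) = (if r = c then - 1 else 0)] (mod 4)" if rc: "r < 3" "c < 3" for r c
      proof (cases "r = c")
        case True
        then have "odd (f r c)" using diag[OF rc(1)] False by simp
        then show ?thesis using f[OF rc] True by (simp add: cong_iff_dvd_diff) presburger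
      qed (use f[OF rc] off[OF rc] in \<open>auto simp: cong_iff_dvd_diff\<close>)
      then show False by (rule SL_3_not_minus_one_mod_4[OF kc])
    qed
  qed
  have three: "3 \<le> (3::nat)" by simp
  note unit = nonscalar_realizes_units[OF three rf nonscalar]
  \<comment> \<open>Bracketing \<open>E\<^sub>i\<^sub>j\<close> with \<open>E\<^sub>j\<^sub>i\<close> gives \<open>E\<^sub>j\<^sub>j - E\<^sub>i\<^sub>i - E\<^sub>j\<^sub>i\<close>.\<close>
  have diag: "realizes 3 L (\<lambda>r c. matrix_unit i i r c - matrix_unit j j r c)"
    if ij: "i < 3" "j < 3" "i \<noteq> j" for i j
    using realizes_add[OF unit[OF ij(2,1)] realizes_bracket[OF unit[OF ij] ij(2,1)]] ij
    by (auto elim!: realizes_cong simp: matrix_unit_def)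
  have Gam: "congruence_subgroup 3 2 \<subseteq> L"
  proof
    fix h assume "h \<in> congruence_subgroup 3 2"
    then have hc: "h \<in> carrier (SL 3)" and h2: "mat_cong 3 2 h (1\<^sub>m 3)"
      by (auto simp: congruence_subgroup_def)
    obtain f where f: "\<And>r c. r < 3 \<Longrightarrow> c < 3 \<Longrightarrow> h $$ (r, c) = (if r = c then 1 else 0) + 2 * f r c"
      using near_one_expand[OF h2] by blast
    \<comment> \<open>The determinant of \<open>1 + 2 f\<close> is \<open>1 + 2 tr f\<close> modulo 4.\<close>
    have trace: "even (f 0 0 + f 1 1 + f 2 2)"
    proof -
      have "1 = (1 + 2 * f 0 0) * ((1 + 2 * f 1 1) * (1 + 2 * f 2 2) - 2 * f 1 2 * (2 * f 2 1))
          - 2 * f 0 1 * (2 * f 1 0 * (1 + 2 * f 2 2) - 2 * f 1 2 * (2 * f 2 0))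
          + 2 * f 0 2 * (2 * f 1 0 * (2 * f 2 1) - (1 + 2 * f 1 1) * (2 * f 2 0))"
        using SL_det[OF hc] unfolding det_3[OF SL_carrier_mat[OF hc]] by (simp add: f)
      also have "\<dots> = 1 + 2 * (f 0 0 + f 1 1 + f 2 2) + 4 * (f 0 0 * f 1 1 + f 0 0 * f 2 2 + f 1 1 * f 2 2
          - f 0 1 * f 1 0 - f 0 2 * f 2 0 - f 1 2 * f 2 1 + 2 * (f 0 0 * (f 1 1 * f 2 2 - f 1 2 * f 2 1)
          - f 0 1 * (f 1 0 * f 2 2 - f 1 2 * f 2 0) + f 0 2 * (f 1 0 * f 2 1 - f 1 1 * f 2 0)))"
        (is "_ = 1 + 2 * ?t + 4 * ?q")
        by (simp add: algebra_simps)
      finally have "1 = 1 + 2 * ?t + 4 * ?q" .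
      moreover have "even t" if "1 = 1 + 2 * t + 4 * q" for t q :: int
        using that by presburger
      ultimately show ?thesis by blast
    qed
    have "realizes 3 L (\<lambda>r c. f 0 1 * matrix_unit 0 1 r c + f 0 2 * matrix_unit 0 2 r c +
        f 1 0 * matrix_unit 1 0 r c + f 1 2 * matrix_unit 1 2 r c + f 2 0 * matrix_unit 2 0 r c +
        f 2 1 * matrix_unit 2 1 r c + f 0 0 * (matrix_unit 0 0 r c - matrix_unit 2 2 r c) +
        f 1 1 * (matrix_unit 1 1 r c - matrix_unit 2 2 r c))"
      by (intro realizes_add realizes_scale unit diag) simp_all
    then have "realizes 3 L f"
      by (rule realizes_cong) (use trace in \<open>auto simp: matrix_unit_def less_3_cases\<close>)
    then obtain k where k: "k \<in> L" "\<And>r c. r < 3 \<Longrightarrow> c < 3 \<Longrightarrow>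
        [k $$ (r, c) = (if r = c then 1 else 0) + 2 * f r c] (mod 4)"
      by (auto simp: realizes_def)
    have "mat_cong 3 4 h k"
      unfolding mat_cong_def using k(2) f by (simp add: cong_sym)
    then show "h \<in> L" by (rule congruent_to_member[OF L Gam4 k(1) hc])
  qed
  have "elem_mat 3 i j \<in> L" if "i < 3" "j < 3" "i \<noteq> j" for i j
    using elem[OF that] congruent_to_member[OF L Gam _ elem_SL[OF that(3)]] mat_cong_sym by blast
  then show ?thesis by (rule SL_generated_by_elem_mod_2[OF L Gam])
qed

text \<open>
  With matrix units \<open>E\<^sub>i\<^sub>j\<close>, modulo 4, \<open>a = 1 + 2 (E\<^sub>0\<^sub>1 + E\<^sub>1\<^sub>2)\<close> and \<open>b = 1 + 2 E\<^sub>0\<^sub>1\<close>. If \<open>b = m a m'\<close>, then \<open>m m'\<close> is congruent to 1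
  modulo 2, hence modulo 4, so that \<open>b m \<equiv> m a\<close> modulo 4 and \<open>m\<close> conjugates a nilpotent matrix of rank 2
  to one of rank 1 modulo 2.
\<close>

lemma primitive_not_two_transitive_dim_3:
  "\<exists>(X :: int mat set set) \<phi>.
    primitive_action (SL 3 :: int mat monoid) X \<phi> \<and>
    \<not> two_transitive_action (SL 3 :: int mat monoid) X \<phi>"
proof -
  let ?M = lift_stabilizer and ?b = "addrow_mat 3 (2::int) 0 1" and ?e = "addrow_mat 3 (2::int) 1 2"
  let ?a = "?b * ?e"
  note M = lift_stabilizer_subgroup
  have bc: "?b \<in> carrier (SL 3)" and ec: "?e \<in> carrier (SL 3)" by (simp_all add: elem_SL)
  have ac: "?a \<in> carrier (SL 3)" using bc ec by (rule SL_mult_closed)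
  have b2: "mat_cong 3 2 ?b (1\<^sub>m 3)" and e2: "mat_cong 3 2 ?e (1\<^sub>m 3)"
    by (auto simp: mat_cong_def cong_2_iff)
  have a2: "mat_cong 3 2 ?a (1\<^sub>m 3)"
    using mat_cong_mult[OF b2 e2 bc SL_one_closed ec SL_one_closed] by simp
  have a01: "?a $$ (0, 1) = 2"
    using mult_elem_entry[of ?b 3 1 2 0 1 2] by (simp del: index_mult_mat)
  have bM: "?b \<notin> ?M"
  proof
    assume "?b \<in> ?M"
    from lift_stabilizer_near_one[OF this b2] have "[?b $$ (0, 1) = 1\<^sub>m 3 $$ (0, 1)] (mod 4)"
      unfolding mat_cong_def by (elim allE[of _ 0] allE[of _ 1] impE) simp_all
    then show False by (simp add: cong_def)
  qed
  have aM: "?a \<notin> ?M"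
  proof
    assume "?a \<in> ?M"
    from lift_stabilizer_near_one[OF this a2] have "[?a $$ (0, 1) = 1\<^sub>m 3 $$ (0, 1)] (mod 4)"
      unfolding mat_cong_def by (elim allE[of _ 0] allE[of _ 1] impE) simp_all
    then show False unfolding a01 by (simp add: cong_def)
  qed
  have "?b \<noteq> m * ?a * m'" if m: "m \<in> ?M" and m': "m' \<in> ?M" for m m'
  proof
    assume eq: "?b = m * ?a * m'"
    have mc: "m \<in> carrier (SL 3)" and mc': "m' \<in> carrier (SL 3)"
      using m m' by (auto simp: lift_stabilizer_def)
    have ma: "m * ?a \<in> carrier (SL 3)" using mc ac by (rule SL_mult_closed)
    define d where "d = m * m'"
    have dc: "d \<in> carrier (SL 3)" unfolding d_def using mc mc' by (rule SL_mult_closed)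
    have "mat_cong 3 2 (m * ?a * m') (m * 1\<^sub>m 3 * m')"
      by (intro mat_cong_mult mat_cong_refl a2 SL_mult_closed mc mc' ac SL_one_closed)
    then have "mat_cong 3 2 d ?b"
      unfolding d_def eq[symmetric] by (simp only: SL_r_one[OF mc] mat_cong_sym)
    then have "mat_cong 3 2 d (1\<^sub>m 3)" using b2 by (rule mat_cong_trans)
    then have d4: "mat_cong 3 4 d (1\<^sub>m 3)"
      unfolding d_def using lift_stabilizer_near_one[OF lift_stabilizer_mult[OF m m']] by blast
    let ?i = "inv\<^bsub>SL 3\<^esub> m"
    have ic: "?i \<in> carrier (SL 3)" using mc by (rule SL.inv_closed)
    have mai: "m * ?a * ?i \<in> carrier (SL 3)" using ma ic by (rule SL_mult_closed)
    have m'_eq: "?i * d = m'"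
      unfolding d_def by (simp only: SL_assoc[OF ic mc mc', symmetric] SL_l_inv[OF mc] SL_l_one[OF mc'])
    have "m * ?a * ?i * d = m * ?a * (?i * d)" by (rule SL_assoc[OF ma ic dc])
    also have "\<dots> = ?b" by (simp only: m'_eq eq[symmetric])
    finally have "m * ?a * ?i * d * m = ?b * m" by (rule arg_cong)
    then have bm: "m * ?a * ?i * (d * m) = ?b * m" by (simp only: SL_assoc[OF mai dc mc])
    have "mat_cong 3 4 (m * ?a * ?i * (d * m)) (m * ?a * ?i * (1\<^sub>m 3 * m))"
      by (intro mat_cong_mult mat_cong_refl d4 SL_mult_closed mai mc dc SL_one_closed)
    moreover have "m * ?a * ?i * (1\<^sub>m 3 * m) = m * ?a"
      by (simp only: SL_l_one[OF mc] SL_assoc[OF ma ic mc] SL_l_inv[OF mc] SL_r_one[OF ma])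
    ultimately have cong: "mat_cong 3 4 (?b * m) (m * ?a)" by (simp only: bm)
    have mcm: "m \<in> carrier_mat 3 3" using mc by (rule SL_carrier_mat)
    have left: "(?b * m) $$ (r, c) = m $$ (r, c) + (if r = 0 then 2 * m $$ (1, c) else 0)"
      if "r < 3" "c < 3" for r c
      using elem_mult_entry[OF mcm _ _ that, of 0 1 2] by simp
    have mb: "m * ?b \<in> carrier_mat 3 3" using mcm by simp
    have "m * ?a = m * ?b * ?e" by (simp only: SL_assoc[OF mc bc ec])
    then have right: "(m * ?a) $$ (r, c) = m $$ (r, c) + (if c = 1 then 2 * m $$ (r, 0) else 0) +
        (if c = 2 then 2 * (m $$ (r, 1) + 2 * m $$ (r, 0)) else 0)" if "r < 3" "c < 3" for r c
      using mult_elem_entry[OF mb _ _ that, of 1 2 2] mult_elem_entry[OF mcm _ _ that(1), of 0 1 _ 2] that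
      by (simp del: index_mult_mat)
    have eqs: "[m $$ (r, c) + (if r = 0 then 2 * m $$ (1, c) else 0) = m $$ (r, c) +
        (if c = 1 then 2 * m $$ (r, 0) else 0) +
        (if c = 2 then 2 * (m $$ (r, 1) + 2 * m $$ (r, 0)) else 0)] (mod 4)" if "r < 3" "c < 3" for r c
    proof -
      have "[(?b * m) $$ (r, c) = (m * ?a) $$ (r, c)] (mod 4)"
        using cong that unfolding mat_cong_def by blast
      then show ?thesis unfolding left[OF that] right[OF that] .
    qed
    have "even (m $$ (1, 0))" "even (m $$ (2, 0))" "even (m $$ (1, 1))"
      using eqs[of 1 1] eqs[of 2 1] eqs[of 1 2] by (simp_all add: cong_iff_dvd_diff) presburger+
    moreover have "even (m $$ (1, 1)) \<longleftrightarrow> even (m $$ (0, 0))"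
      using eqs[of 0 1] by (simp add: cong_iff_dvd_diff) presburger
    ultimately have "even (m $$ (i, 0))" if "i < 3" for i
      using that unfolding less_3_cases by auto
    then show False
      using SL_column_not_divisible[OF mc, of 0 2] by auto
  qed
  then have "\<not> two_transitive_action (SL 3) (coset_space (SL 3) ?M) (coset_action (SL 3) ?M)"
    by (intro SL.coset_action_not_two_transitive[OF M ac bc aM bM]) simp
  moreover have "primitive_action (SL 3) (coset_space (SL 3) ?M) (coset_action (SL 3) ?M)"
    by (rule SL.coset_action_primitive[OF M]) (rule lift_stabilizer_maximal)
  ultimately show ?thesis by blast
qed

theorem theorem1p4:
  fixes n :: nat
  assumes "n \<ge> 3"
  shows "\<exists>(X :: int mat set set) \<phi>.
    primitive_action (SL n :: int mat monoid) X \<phi> \<and>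
    \<not> two_transitive_action (SL n :: int mat monoid) X \<phi>"
proof (cases "n = 3")
  case True
  then show ?thesis using primitive_not_two_transitive_dim_3 by simp
next
  case False
  then show ?thesis using assms by (intro primitive_not_two_transitive_dim_ge_4) simp
qed

end
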